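(* Let $G$ be a (finite) vertex-transitive connected graph with vertex set $V$. Denote by $m_k$, $1\le k\le K$, the multiplicities of the distinct non-trivial eigenvalues of the adjacency matrix of $G$. Let $M\in\mathbb{N}$ and let $f_1,\dots,f_M\in L^2(V)$ be a collection of real-valued functions. Then, for any $t>0$, with probability at least $$1-M\sum_{k=1}^Km_k\left(3e^{-\frac{t\sqrt{m_k}}{8}}+e^{-\frac{m_k}{12}}\right)$$ with respect to the choice of an orthonormal eigenbasis $\mathcal{B}\in\mathcal{B}(G)$ according to $\nu$, the following holds: for any $u\in\mathcal{B}$ and any $i=1,\dots,M$, $$\left|\sum_{x\in V}f_i(x)u(x)^2-\frac{1}{|V|}\sum_{x\in V}f_i(x)\right|\le t\,\frac{\|f_i\|_{L^2}}{\sqrt{|V|}}.$$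
   Context: A graph is vertex-transitive if its automorphism group acts transitively on its vertices. The trivial eigenvalue is the common degree $d$ of the vertices (it is simple, with constant eigenvectors, since $G$ is connected); non-trivial eigenvalues are the others. $\|f\|_{L^2}=(\sum_{x\in V}|f(x)|^2)^{1/2}$. $\mathcal{B}(G)$ is the set of orthonormal eigenbases of the adjacency matrix $A_G$, with its uniform probability measure $\nu$: for each distinct eigenspace $F\subset\mathbb{R}^V$ of $A_G$, the set of orthonormal bases of $F$ is identified with the orthogonal group $O(\dim F)$ (by fixing a reference orthonormal basis) and endowed with the Haar probability measure; $\mathcal{B}(G)$ is the product of these sets over all distinct eigenspaces (an element being an orthonormal basis of $L^2(V)$ obtained as the union of orthonormal bases of the eigenspaces) and $\nu$ is the product of these Haar probability measures. *)

theory Defs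
  imports "HOL-Probability.Probability" "Graph_Theory.Graph_Theory"
begin

text \<open>
  Graphs are finite simple graphs in the sense of \<^locale>\<open>pair_graph\<close> (symmetric loop-free
  digraphs without parallel arcs). The vertex set is a whole finite type \<open>'v\<close>, so that
  \<open>L\<^sup>2(V)\<close> is \<^typ>\<open>real ^ 'v\<close> and its norm is the \<open>L\<^sup>2\<close>-norm (counting measure).
\<close>

definition graph_automorphism ::
  "'v pair_pre_digraph \<Rightarrow> ('v, 'v \<times> 'v, 'v, 'v \<times> 'v) digraph_isomorphism \<Rightarrow> bool" where
  "graph_automorphism G h \<longleftrightarrow>
     pre_digraph.digraph_isomorphism (with_proj G) h \<and> app_iso h (with_proj G) = with_proj G"

definition vertex_transitive :: "'v pair_pre_digraph \<Rightarrow> bool" where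
  "vertex_transitive G \<longleftrightarrow>
     (\<forall>x\<in>pverts G. \<forall>y\<in>pverts G. \<exists>h. graph_automorphism G h \<and> iso_verts h x = y)"

definition adjacency_matrix :: "'v::finite pair_pre_digraph \<Rightarrow> real ^ 'v ^ 'v" where
  "adjacency_matrix G = (\<chi> x y. if (x, y) \<in> parcs G then 1 else 0)"

text \<open>Meaningful when \<open>G\<close> is regular, which vertex-transitivity guarantees.\<close>

definition common_degree :: "'v pair_pre_digraph \<Rightarrow> nat" where
  "common_degree G = (THE d. \<forall>x\<in>pverts G. out_degree (with_proj G) x = d)"

definition eigenspace :: "real ^ 'v ^ 'v \<Rightarrow> real \<Rightarrow> (real ^ 'v::finite) set" where
  "eigenspace A l = {u. A *v u = l *\<^sub>R u}"

definition eigenvalues :: "real ^ 'v ^ 'v \<Rightarrow> real set" where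
  "eigenvalues (A :: real ^ 'v ^ 'v::finite) = {l. \<exists>u. u \<noteq> 0 \<and> A *v u = l *\<^sub>R u}"

definition multiplicity_of :: "real ^ 'v ^ 'v::finite \<Rightarrow> real \<Rightarrow> nat" where
  "multiplicity_of A l = dim (eigenspace A l)"

definition nontrivial_eigenvalues :: "'v::finite pair_pre_digraph \<Rightarrow> real set" where
  "nontrivial_eigenvalues G = eigenvalues (adjacency_matrix G) - {real (common_degree G)}"


text \<open>
  The size \<open>m\<close> of the orthogonal groups below is not fixed by a type, so an \<open>m \<times> m\<close> matrix is an
  extensional function on \<open>{..<m} \<times> {..<m}\<close>. Since this index set is finite, the product
  \<open>\<sigma>\<close>-algebra of the entries is the Borel \<open>\<sigma>\<close>-algebra. The measure carried by
  \<open>orthogonal_group_space\<close> (and by \<open>onb_space\<close>) is irrelevant; only its \<open>\<sigma>\<close>-algebra is used.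
\<close>

type_synonym sqmat = "nat \<times> nat \<Rightarrow> real"

definition orthogonal_group :: "nat \<Rightarrow> sqmat set" where
  "orthogonal_group m = {Q \<in> ({..<m} \<times> {..<m}) \<rightarrow>\<^sub>E UNIV.
     \<forall>i<m. \<forall>j<m. (\<Sum>k<m. Q (k, i) * Q (k, j)) = (if i = j then 1 else 0)}"

definition sqmat_mult :: "nat \<Rightarrow> sqmat \<Rightarrow> sqmat \<Rightarrow> sqmat" where
  "sqmat_mult m R Q = (\<lambda>(i, j) \<in> {..<m} \<times> {..<m}. \<Sum>k<m. R (i, k) * Q (k, j))"

definition orthogonal_group_space :: "nat \<Rightarrow> sqmat measure" where
  "orthogonal_group_space m =
     restrict_space (\<Pi>\<^sub>M p \<in> {..<m} \<times> {..<m}. borel) (orthogonal_group m)"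

definition haar_probability :: "nat \<Rightarrow> sqmat measure \<Rightarrow> bool" where
  "haar_probability m H \<longleftrightarrow>
     prob_space H \<and> sets H = sets (orthogonal_group_space m) \<and>
     (\<forall>R\<in>orthogonal_group m. distr H H (sqmat_mult m R) = H)"


text \<open>Orthonormal bases are ordered, which is what the identification with \<open>O(dim F)\<close> requires.\<close>

definition orthonormal_bases :: "(real ^ 'v::finite) set \<Rightarrow> (nat \<Rightarrow> real ^ 'v) set" where
  "orthonormal_bases F = {e \<in> {..<dim F} \<rightarrow>\<^sub>E UNIV.
     (\<forall>i<dim F. \<forall>j<dim F. e i \<bullet> e j = (if i = j then 1 else 0)) \<and> span (e ` {..<dim F}) = F}"

definition onb_space :: "(real ^ 'v::finite) set \<Rightarrow> (nat \<Rightarrow> real ^ 'v) measure" where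
  "onb_space F = restrict_space (\<Pi>\<^sub>M j \<in> {..<dim F}. borel) (orthonormal_bases F)"

text \<open>
  The identification of \<open>O(dim F)\<close> with the orthonormal bases of \<open>F\<close> given by a reference
  basis \<open>b\<close>: the columns of the matrix are the coordinates, with respect to \<open>b\<close>, of the vectors
  of the new basis.
\<close>

definition onb_of_matrix ::
  "(real ^ 'v::finite) set \<Rightarrow> (nat \<Rightarrow> real ^ 'v) \<Rightarrow> sqmat \<Rightarrow> nat \<Rightarrow> real ^ 'v" where
  "onb_of_matrix F b Q = (\<lambda>j\<in>{..<dim F}. \<Sum>i<dim F. Q (i, j) *\<^sub>R b i)"

text \<open>
  The measure \<open>\<nu>\<close>, for Haar probability measures \<open>H m\<close> on \<open>O(m)\<close> and reference bases \<open>b l\<close> of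
  the eigenspaces. A point \<open>\<omega>\<close> of its space assigns to each eigenvalue an orthonormal basis of
  the eigenspace; \<open>basis_vectors\<close> is the union of these bases.
\<close>

definition eigenbasis_measure ::
  "real ^ 'v ^ 'v::finite \<Rightarrow> (nat \<Rightarrow> sqmat measure) \<Rightarrow> (real \<Rightarrow> nat \<Rightarrow> real ^ 'v)
     \<Rightarrow> (real \<Rightarrow> nat \<Rightarrow> real ^ 'v) measure" where
  "eigenbasis_measure A H b = (\<Pi>\<^sub>M l \<in> eigenvalues A.
     distr (H (multiplicity_of A l)) (onb_space (eigenspace A l))
       (onb_of_matrix (eigenspace A l) (b l)))"

definition basis_vectors ::
  "real ^ 'v ^ 'v::finite \<Rightarrow> (real \<Rightarrow> nat \<Rightarrow> real ^ 'v) \<Rightarrow> (real ^ 'v) set" where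
  "basis_vectors A \<omega> = (\<Union>l\<in>eigenvalues A. \<omega> l ` {..<multiplicity_of A l})"

end

theory Submission
  imports Defs
begin

text \<open>
  Fix an eigenspace \<open>F\<close> of dimension \<open>m\<close>, put \<open>n = |V|\<close>, and diagonalize the quadratic form
  \<open>u \<mapsto> \<Sum>x. f(x) u(x)\<^sup>2\<close> on \<open>F\<close> in an orthonormal basis \<open>e\<close>, with eigenvalues \<open>\<mu>\<^sub>k\<close>.
  By vertex-transitivity \<open>\<Sum>k. e\<^sub>k(x)\<^sup>2 = m/n\<close> for all \<open>x\<close>; hence the \<open>\<mu>\<^sub>k\<close> have mean equal to the
  mean of \<open>f\<close>, and Cauchy-Schwarz gives \<open>\<Sum>k. \<mu>\<^sub>k\<^sup>2 \<le> m |f|\<^sup>2 / n\<close>. Each vector of a random basis of \<open>F\<close>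
  is uniform on the unit sphere, that is, distributed as \<open>g / |g|\<close> for a standard Gaussian vector \<open>g\<close>
  of \<open>F\<close>, so it remains to bound the probability that
  \<open>|\<Sum>k. \<lambda>\<^sub>k g\<^sub>k\<^sup>2| > (t s / \<surd>m) |g|\<^sup>2\<close>, where \<open>\<Sum>k. \<lambda>\<^sub>k = 0\<close> and \<open>\<Sum>k. \<lambda>\<^sub>k\<^sup>2 \<le> s\<^sup>2\<close>.
  Chernoff bounds show that \<open>|g|\<^sup>2 < m/2\<close> has probability at most \<open>exp(-m/12)\<close>, and that
  \<open>|\<Sum>k. \<lambda>\<^sub>k g\<^sub>k\<^sup>2| > t s \<surd>m / 2\<close> has probability at most \<open>2 exp(1/4) exp(-t \<surd>m / 8)\<close>.
  A union bound over the vectors of the basis finishes the proof; the trivial eigenspace consists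
  of constants, for which there is no deviation at all.
\<close>

subsection \<open>Standard Gaussian vectors\<close>

text \<open>Multiplying the standard density by \<open>exp (a * x\<^sup>2)\<close> yields
  \<open>s\<close> times the centred normal density of variance \<open>1 / (1 - 2 * a)\<close>, and
  that density has mass 1.\<close>

lemma nn_integral_exp_normal_density:
  fixes a :: real
  assumes "2 * a < 1"
  shows "(\<integral>\<^sup>+x. ennreal (exp (a * x\<^sup>2) * std_normal_density x) \<partial>lborel) = ennreal (1 / sqrt (1 - 2 * a))"
proof -
  define s where "s = 1 / sqrt (1 - 2 * a)"
  have s: "s > 0" "s\<^sup>2 = 1 / (1 - 2 * a)" using assms by (auto simp: s_def power_divide)
  have eq: "exp (a * x\<^sup>2) * std_normal_density x = s * normal_density 0 s x" for x
  proof -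
    have "a * x\<^sup>2 - x\<^sup>2 / 2 = - x\<^sup>2 / (2 * s\<^sup>2)" using assms by (simp add: s field_simps)
    then have "exp (a * x\<^sup>2) * exp (- x\<^sup>2 / 2) = exp (- x\<^sup>2 / (2 * s\<^sup>2))"
      by (simp flip: exp_add)
    moreover have "sqrt (2 * pi * s\<^sup>2) = sqrt (2 * pi) * s" using s(1) by (simp add: real_sqrt_mult)
    ultimately show ?thesis using s(1) by (simp add: normal_density_def field_simps)
  qed
  have "(\<integral>\<^sup>+x. ennreal (exp (a * x\<^sup>2) * std_normal_density x) \<partial>lborel)
      = ennreal s * (\<integral>\<^sup>+x. ennreal (normal_density 0 s x) \<partial>lborel)"
    unfolding eq using s(1) by (simp add: ennreal_mult nn_integral_cmult)
  also have "(\<integral>\<^sup>+x. ennreal (normal_density 0 s x) \<partial>lborel) = 1"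
    using prob_space.emeasure_space_1[OF prob_space_normal_density[of s 0]] s(1)
    by (simp add: emeasure_density)
  finally show ?thesis by (simp add: s_def)
qed

text \<open>A density against \<open>lborel\<close>: its product form separates the axes, while
  rotation invariance is inherited from \<open>lborel\<close>.\<close>

definition std_gaussian :: "'a::euclidean_space measure" where
  "std_gaussian = density lborel (\<lambda>x. ennreal (\<Prod>b\<in>Basis. std_normal_density ((x :: 'a) \<bullet> b)))"

lemma sets_std_gaussian [simp, measurable_cong]: "sets std_gaussian = sets borel"
  by (simp add: std_gaussian_def)

lemma space_std_gaussian [simp]: "space std_gaussian = UNIV"
  by (simp add: std_gaussian_def)

lemma std_gaussian_mgf_axes:
  fixes c :: "'a::euclidean_space \<Rightarrow> real"
  assumes "\<And>b. b \<in> Basis \<Longrightarrow> 2 * c b < 1"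
  shows "(\<integral>\<^sup>+g. ennreal (exp (\<Sum>b\<in>Basis. c b * (g \<bullet> b)\<^sup>2)) \<partial>std_gaussian)
    = ennreal (\<Prod>b\<in>(Basis :: 'a set). 1 / sqrt (1 - 2 * c b))"
proof -
  have "(\<integral>\<^sup>+g. ennreal (exp (\<Sum>b\<in>Basis. c b * (g \<bullet> b)\<^sup>2)) \<partial>std_gaussian)
    = (\<integral>\<^sup>+g. (\<Prod>b\<in>Basis. ennreal (exp (c b * (g \<bullet> b)\<^sup>2) * std_normal_density (g \<bullet> b))) \<partial>(lborel :: 'a measure))"
    unfolding std_gaussian_def
    by (subst nn_integral_density) (auto intro!: nn_integral_cong simp: prod_ennreal exp_sum ennreal_mult[symmetric] prod.distrib prod_nonneg mult.commute)
  also have "\<dots> = (\<Prod>b\<in>Basis. (\<integral>\<^sup>+x. ennreal (exp (c b * x\<^sup>2) * std_normal_density x) \<partial>lborel))"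
    by (rule nn_integral_lborel_prod) auto
  also have "\<dots> = (\<Prod>b\<in>Basis. ennreal (1 / sqrt (1 - 2 * c b)))"
    using assms by (intro prod.cong refl nn_integral_exp_normal_density) auto
  also have "\<dots> = ennreal (\<Prod>b\<in>Basis. 1 / sqrt (1 - 2 * c b))"
    using assms by (intro prod_ennreal) (auto simp: less_imp_le)
  finally show ?thesis .
qed

lemma prob_space_std_gaussian: "prob_space (std_gaussian :: 'a::euclidean_space measure)"
  \<comment> \<open>Zero exponents turn the generating function into the total mass.\<close>
  using std_gaussian_mgf_axes[of "\<lambda>_. 0"] by (intro prob_spaceI) simp

section \<open>Rotation invariance of Lebesgue and Gaussian measure\<close>

lemma orthogonal_transformation_borel_measurable:
  fixes L :: "'a::euclidean_space \<Rightarrow> 'a"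
  assumes "orthogonal_transformation L"
  shows "L \<in> borel_measurable borel"
  using orthogonal_transformation_linear[OF assms]
  by (intro borel_measurable_continuous_onI linear_continuous_on) (simp add: linear_linear)

lemma distr_lborel_minus: "distr lborel borel (\<lambda>x. t - x) = (lborel :: 'a::euclidean_space measure)"
  using lborel_affine[of "-1" t] by (simp add: density_1)

text \<open>
  Both measures below are translation invariant, so integrating \<open>1\<^sub>A(x) 1\<^sub>B(x + y)\<close> in both orders,
  with \<open>B\<close> the unit ball, shows that they are proportional.
\<close>

lemma distr_lborel_orthogonal:
  fixes L :: "'a::euclidean_space \<Rightarrow> 'a"
  assumes L: "orthogonal_transformation L"
  shows "distr lborel borel L = lborel"
proof (rule measure_eqI)
  have [measurable]: "L \<in> borel_measurable borel"
    by (rule orthogonal_transformation_borel_measurable[OF L])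
  fix A :: "'a set" assume "A \<in> sets (distr lborel borel L)"
  then have [measurable]: "A \<in> sets borel" by simp
  define B :: "'a set" where "B = ball 0 1"
  have [measurable]: "B \<in> sets borel" by (simp add: B_def)
  \<comment> \<open>Since \<open>L\<close> preserves \<open>B\<close>, both orders of integration
    produce the same factor \<open>emeasure lborel B\<close>, finite and nonzero; hence the constant
    of proportionality is 1.\<close>
  have LB: "L x \<in> B \<longleftrightarrow> x \<in> B" for x
    using orthogonal_transformation_norm[OF L, of x] by (simp add: B_def)
  have indLB: "indicator B (L x) = (indicator B x :: ennreal)" for x
    by (simp add: indicator_def LB)
  \<comment> \<open>A translation after \<open>L\<close> is a translation before \<open>L\<close>,
    under which \<open>lborel\<close> is invariant.\<close>
  have Lsub: "L x - y = L (x - inv L y)" for x y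
    using orthogonal_transformation_linear[OF L] orthogonal_transformation_surj[OF L]
    by (simp add: linear_diff surj_f_inv_f)
  have shift: "(\<integral>\<^sup>+x. g (x + t) \<partial>lborel) = (\<integral>\<^sup>+x. g x \<partial>lborel)"
    if [measurable]: "g \<in> borel_measurable borel" for g :: "'a \<Rightarrow> ennreal" and t
    by (subst (2) lborel_distr_plus[of t, symmetric]) (simp add: nn_integral_distr add.commute)
  have refl: "(\<integral>\<^sup>+x. g (t - x) \<partial>lborel) = (\<integral>\<^sup>+x. g x \<partial>lborel)"
    if [measurable]: "g \<in> borel_measurable borel" for g :: "'a \<Rightarrow> ennreal" and t
    by (subst (2) distr_lborel_minus[of t, symmetric]) (simp add: nn_integral_distr)
  let ?l = "lborel :: 'a measure"
  have "(\<integral>\<^sup>+x. indicator A (L x) \<partial>?l) * emeasure ?l B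
      = (\<integral>\<^sup>+x. (\<integral>\<^sup>+y. indicator A (L x) * indicator B (y + L x) \<partial>?l) \<partial>?l)"
    by (simp add: nn_integral_cmult nn_integral_multc shift)
  also have "\<dots> = (\<integral>\<^sup>+y. (\<integral>\<^sup>+x. indicator A (L x) * indicator B (y + L x) \<partial>?l) \<partial>?l)"
    by (rule lborel_pair.Fubini') measurable
  also have "\<dots> = (\<integral>\<^sup>+y. (\<integral>\<^sup>+x. indicator A (L x - y) * indicator B (L x) \<partial>?l) \<partial>?l)"
  proof (rule nn_integral_cong)
    fix y
    have "(\<integral>\<^sup>+x. indicator A (L x) * indicator B (y + L x) \<partial>?l)
        = (\<integral>\<^sup>+x. indicator A (L (x + - inv L y)) * indicator B (y + L (x + - inv L y)) \<partial>?l)"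
      by (rule shift[symmetric]) measurable
    then show "(\<integral>\<^sup>+x. indicator A (L x) * indicator B (y + L x) \<partial>?l)
        = (\<integral>\<^sup>+x. indicator A (L x - y) * indicator B (L x) \<partial>?l)"
      by (simp add: Lsub[symmetric])
  qed
  also have "\<dots> = (\<integral>\<^sup>+x. (\<integral>\<^sup>+y. indicator A (L x - y) * indicator B (L x) \<partial>?l) \<partial>?l)"
    by (rule lborel_pair.Fubini') measurable
  also have "\<dots> = emeasure ?l A * emeasure ?l B"
    by (simp add: nn_integral_cmult nn_integral_multc refl indLB)
  also have "(\<integral>\<^sup>+x. indicator A (L x) \<partial>?l) = emeasure (distr lborel borel L) A"
  proof -
    have "(\<integral>\<^sup>+x. indicator A (L x) \<partial>?l) = (\<integral>\<^sup>+x. indicator A x \<partial>distr lborel borel L)"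
      by (rule nn_integral_distr[symmetric]) measurable
    then show ?thesis by simp
  qed
  finally have *: "emeasure (distr lborel borel L) A * emeasure ?l B = emeasure ?l A * emeasure ?l B" .
  have "emeasure ?l B \<noteq> 0" "emeasure ?l B \<noteq> \<infinity>"
    using content_ball_pos[of 1 "0::'a"] emeasure_lborel_ball_finite[of "0::'a" 1]
    by (auto simp: B_def measure_def)
  with * show "emeasure (distr lborel borel L) A = emeasure lborel A"
    by (metis infinity_ennreal_def mult_divide_eq_ennreal)
qed simp

text \<open>The density is a function of the norm alone, which is why orthogonal maps leave it
  unchanged.\<close>

lemma prod_std_normal_density:
  "(\<Prod>b\<in>Basis. std_normal_density ((x :: 'a::euclidean_space) \<bullet> b))
     = (1 / sqrt (2 * pi)) ^ DIM('a) * exp (- (norm x)\<^sup>2 / 2)"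
proof -
  have "(norm x)\<^sup>2 = (\<Sum>b\<in>Basis. (x \<bullet> b)\<^sup>2)"
    by (simp add: power2_norm_eq_inner euclidean_inner[of x x] flip: power2_eq_square)
  then have "exp (- (norm x)\<^sup>2 / 2) = (\<Prod>b\<in>Basis. exp (- (x \<bullet> b)\<^sup>2 / 2))"
    by (simp add: sum_negf sum_divide_distrib flip: exp_sum)
  then show ?thesis
    by (simp add: normal_density_def prod_dividef power_one_over)
qed

lemma distr_std_gaussian_orthogonal:
  fixes L :: "'a::euclidean_space \<Rightarrow> 'a"
  assumes L: "orthogonal_transformation L"
  shows "distr std_gaussian std_gaussian L = std_gaussian"
proof -
  have [measurable]: "L \<in> borel_measurable borel"
    by (rule orthogonal_transformation_borel_measurable[OF L])
  let ?d = "\<lambda>x::'a. ennreal (\<Prod>b\<in>Basis. std_normal_density (x \<bullet> b))"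
  have d: "?d (L x) = ?d x" for x
    using orthogonal_transformation_norm[OF L] by (simp add: prod_std_normal_density)
  have "distr std_gaussian borel L = distr (density lborel (\<lambda>x. ?d (L x))) borel L"
    by (simp add: std_gaussian_def d)
  also have "\<dots> = density (distr lborel borel L) ?d"
    by (subst density_distr) auto
  also have "\<dots> = std_gaussian" by (simp add: distr_lborel_orthogonal[OF L] std_gaussian_def)
  finally show ?thesis by (simp cong: distr_cong)
qed

section \<open>Generating functions along arbitrary orthonormal systems\<close>

definition orthonormal_system :: "nat \<Rightarrow> (nat \<Rightarrow> 'a::real_inner) \<Rightarrow> bool" where
  "orthonormal_system m e \<longleftrightarrow> (\<forall>i<m. \<forall>j<m. e i \<bullet> e j = (if i = j then 1 else 0))"

lemma orthonormal_systemD: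
  "orthonormal_system m e \<Longrightarrow> i < m \<Longrightarrow> j < m \<Longrightarrow> e i \<bullet> e j = (if i = j then 1 else 0)"
  by (auto simp: orthonormal_system_def)

lemma orthonormal_system_inj_on: "orthonormal_system m e \<Longrightarrow> inj_on e {..<m}"
proof (rule inj_onI)
  fix i j assume "orthonormal_system m e" "i \<in> {..<m}" "j \<in> {..<m}" "e i = e j"
  then show "i = j" using orthonormal_systemD[of m e i j] orthonormal_systemD[of m e j j]
    by (auto split: if_splits)
qed

lemma orthonormal_system_independent:
  fixes e :: "nat \<Rightarrow> 'a::euclidean_space"
  assumes "orthonormal_system m e"
  shows "independent (e ` {..<m})"
proof (rule pairwise_orthogonal_independent)
  show "pairwise orthogonal (e ` {..<m})"
    using orthonormal_systemD[OF assms] by (auto simp: pairwise_def orthogonal_def split: if_splits)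
  show "0 \<notin> e ` {..<m}"
    using orthonormal_systemD[OF assms] by force
qed

text \<open>A rotation carrying axes to the given vectors reduces computations along
  \<open>e\<close> to computations along axes. It comes from completing \<open>e\<close> to an
  orthonormal basis of the whole space and matching that basis with \<open>Basis\<close> by an
  arbitrary bijection.\<close>

lemma orthonormal_system_extend:
  fixes e :: "nat \<Rightarrow> 'a::euclidean_space"
  assumes e: "orthonormal_system m e"
  obtains L :: "'a \<Rightarrow> 'a" and \<beta> where "orthogonal_transformation L" "inj_on \<beta> {..<m}" "\<beta> ` {..<m} \<subseteq> Basis"
    "\<And>i. i < m \<Longrightarrow> L (\<beta> i) = e i"
proof -
  let ?S = "e ` {..<m}"
  have S: "pairwise orthogonal ?S" "finite ?S"
    using orthonormal_systemD[OF e] by (auto simp: pairwise_def orthogonal_def split: if_splits)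
  have S1: "\<And>x. x \<in> ?S \<Longrightarrow> norm x = 1" using orthonormal_systemD[OF e] by (auto simp: norm_eq_1)
  obtain U where U: "pairwise orthogonal (?S \<union> U)" "span (?S \<union> U) = span (?S \<union> Basis)"
    using orthogonal_extension[OF S(1)] by metis
  \<comment> \<open>The completion \<open>U\<close> may contain zero and vectors of any length; the
    vectors of \<open>e\<close> have norm 1 and survive the normalization.\<close>
  define B where "B = (\<lambda>x. x /\<^sub>R norm x) ` (?S \<union> U - {0})"
  have SB: "?S \<subseteq> B"
  proof
    fix x assume "x \<in> ?S"
    moreover then have "norm x = 1" by (rule S1)
    ultimately show "x \<in> B" unfolding B_def by (intro image_eqI[of _ _ x]) auto
  qed
  have B1: "\<And>x. x \<in> B \<Longrightarrow> norm x = 1" by (auto simp: B_def simp flip: divide_inverse_commute split: if_splits)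
  have Borth: "pairwise orthogonal B"
  proof -
    have "(x /\<^sub>R norm x) \<bullet> (y /\<^sub>R norm y) = 0"
      if "x \<in> ?S \<union> U" "y \<in> ?S \<union> U" "x /\<^sub>R norm x \<noteq> y /\<^sub>R norm y" for x y
    proof -
      have "x \<noteq> y" using that(3) by auto
      then have "x \<bullet> y = 0" using U(1) that(1,2) unfolding pairwise_def orthogonal_def by blast
      then show ?thesis by simp
    qed
    then show ?thesis unfolding B_def pairwise_def orthogonal_def by blast
  qed
  have "0 \<notin> B" using B1 by force
  then have Bind: "independent B" by (rule pairwise_orthogonal_independent[OF Borth])
  have "span B = span (?S \<union> U - {0})"
  proof (rule span_eq[THEN iffD2], intro conjI subsetI)
    fix x assume "x \<in> B"
    then obtain y where "y \<in> ?S \<union> U - {0}" "x = y /\<^sub>R norm y" unfolding B_def by blast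
    then show "x \<in> span (?S \<union> U - {0})" by (simp add: span_scale span_base)
  next
    fix x assume x: "x \<in> ?S \<union> U - {0}"
    then have "norm x *\<^sub>R (x /\<^sub>R norm x) \<in> span B" unfolding B_def by (intro span_scale span_base) auto
    then show "x \<in> span B" using x by simp
  qed
  also have "\<dots> = UNIV" using U(2) by (metis span_Basis span_delete_0 span_mono sup_ge2 top.extremum_unique)
  finally have "card B = DIM('a)" using Bind by (metis dim_UNIV dim_eq_card_independent dim_span)
  moreover have "finite B" using Bind by (rule finiteI_independent)
  moreover have "card ?S = m" by (simp add: card_image orthonormal_system_inj_on[OF e])
  ultimately obtain \<phi> where \<phi>: "bij_betw \<phi> B (Basis :: 'a set)"
    using finite_same_card_bij[of B "Basis :: ('a) set"] by auto
  define \<psi> where "\<psi> = the_inv_into B \<phi>"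
  have \<psi>: "bij_betw \<psi> Basis B" unfolding \<psi>_def by (rule bij_betw_the_inv_into[OF \<phi>])
  have \<psi>\<phi>: "\<psi> (\<phi> x) = x" if "x \<in> B" for x
    using \<phi> that unfolding \<psi>_def by (auto simp: bij_betw_def the_inv_into_f_f)
  define L where "L = (\<lambda>x::'a. \<Sum>b\<in>Basis. (x \<bullet> b) *\<^sub>R \<psi> b)"
  have orth: "\<psi> a \<bullet> \<psi> b = (if a = b then 1 else 0)" if "a \<in> Basis" "b \<in> Basis" for a b
    using that \<psi> B1 Borth by (auto simp: bij_betw_def inj_on_def pairwise_def orthogonal_def norm_eq_1) blast
  have "linear L" unfolding L_def
    by (auto intro!: linearI simp: inner_add_left scaleR_add_left sum.distrib scaleR_sum_right)
  moreover have "L x \<bullet> L y = x \<bullet> y" for x y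
  proof -
    have "L x \<bullet> L y = (\<Sum>a\<in>Basis. \<Sum>b\<in>Basis. (x \<bullet> a) * (y \<bullet> b) * (\<psi> a \<bullet> \<psi> b))"
      by (subst sum.swap) (simp add: L_def inner_sum_left inner_sum_right sum_distrib_left mult_ac)
    also have "\<dots> = (\<Sum>a\<in>Basis. \<Sum>b\<in>Basis. if a = b then (x \<bullet> a) * (y \<bullet> b) else 0)"
      by (intro sum.cong refl) (auto simp: orth)
    also have "\<dots> = x \<bullet> y" by (simp add: euclidean_inner[of x y])
    finally show ?thesis .
  qed
  ultimately have LO: "orthogonal_transformation L" by (simp add: orthogonal_transformation_def)
  have Lb: "L b = \<psi> b" if "b \<in> Basis" for b
  proof -
    have "L b = (\<Sum>a\<in>Basis. if a = b then \<psi> b else 0)"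
      unfolding L_def using that by (intro sum.cong refl) (auto simp: inner_Basis)
    then show ?thesis using that by simp
  qed
  show ?thesis
  proof (rule that[OF LO, of "\<phi> \<circ> e"])
    show "inj_on (\<phi> \<circ> e) {..<m}"
      using \<phi> SB orthonormal_system_inj_on[OF e] by (auto intro!: comp_inj_on intro: inj_on_subset simp: bij_betw_def)
    show "(\<phi> \<circ> e) ` {..<m} \<subseteq> Basis" using \<phi> SB by (auto simp: bij_betw_def)
    show "L ((\<phi> \<circ> e) i) = e i" if "i < m" for i
      using that SB \<phi> by (subst Lb) (auto simp: \<psi>\<phi> bij_betw_def)
  qed
qed

lemma std_gaussian_mgf:
  fixes e :: "nat \<Rightarrow> 'a::euclidean_space"
  assumes e: "orthonormal_system m e" and a: "\<And>i. i < m \<Longrightarrow> 2 * a i < 1"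
  shows "(\<integral>\<^sup>+g. ennreal (exp (\<Sum>i<m. a i * (g \<bullet> e i)\<^sup>2)) \<partial>std_gaussian)
    = ennreal (\<Prod>i<m. 1 / sqrt (1 - 2 * a i))"
proof -
  obtain L :: "'a \<Rightarrow> 'a" and \<beta> where L: "orthogonal_transformation L" and \<beta>: "inj_on \<beta> {..<m}" "\<beta> ` {..<m} \<subseteq> Basis"
    and L\<beta>: "\<And>i. i < m \<Longrightarrow> L (\<beta> i) = e i"
    using orthonormal_system_extend[OF e] by metis
  have [measurable]: "L \<in> borel_measurable borel"
    by (rule orthogonal_transformation_borel_measurable[OF L])
  \<comment> \<open>Axes outside the image of \<open>\<beta>\<close> get coefficient 0, hence add
    nothing to the exponent and a factor 1 to the product.\<close>
  define c where "c = (\<lambda>b. if b \<in> \<beta> ` {..<m} then a (the_inv_into {..<m} \<beta> b) else 0)"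
  have c\<beta>: "c (\<beta> i) = a i" if "i < m" for i
    using that \<beta>(1) by (auto simp: c_def the_inv_into_f_f)
  have Le: "L g \<bullet> e i = g \<bullet> \<beta> i" if "i < m" for g i
    using L that by (metis L\<beta> orthogonal_transformation_def)
  have sm: "(\<Sum>b\<in>Basis. c b * (g \<bullet> b)\<^sup>2) = (\<Sum>i<m. a i * (g \<bullet> \<beta> i)\<^sup>2)" for g :: "'a"
  proof -
    have "(\<Sum>b\<in>Basis. c b * (g \<bullet> b)\<^sup>2) = (\<Sum>b\<in>\<beta> ` {..<m}. c b * (g \<bullet> b)\<^sup>2)"
      using \<beta>(2) by (intro sum.mono_neutral_right) (auto simp: c_def)
    then show ?thesis using \<beta>(1) by (simp add: sum.reindex c\<beta>)
  qed
  have pr: "(\<Prod>b\<in>(Basis :: 'a set). 1 / sqrt (1 - 2 * c b)) = (\<Prod>i<m. 1 / sqrt (1 - 2 * a i))"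
  proof -
    have "(\<Prod>b\<in>(Basis :: 'a set). 1 / sqrt (1 - 2 * c b)) = (\<Prod>b\<in>\<beta> ` {..<m}. 1 / sqrt (1 - 2 * c b))"
      using \<beta>(2) by (intro prod.mono_neutral_right) (auto simp: c_def)
    then show ?thesis using \<beta>(1) by (simp add: prod.reindex c\<beta>)
  qed
  have "(\<integral>\<^sup>+g. ennreal (exp (\<Sum>i<m. a i * (g \<bullet> e i)\<^sup>2)) \<partial>std_gaussian)
    = (\<integral>\<^sup>+g. ennreal (exp (\<Sum>i<m. a i * (g \<bullet> e i)\<^sup>2)) \<partial>distr std_gaussian std_gaussian L)"
    by (simp add: distr_std_gaussian_orthogonal[OF L])
  also have "\<dots> = (\<integral>\<^sup>+g. ennreal (exp (\<Sum>b\<in>Basis. c b * (g \<bullet> b)\<^sup>2)) \<partial>std_gaussian)"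
    by (subst nn_integral_distr) (simp_all add: Le sm)
  also have "\<dots> = ennreal (\<Prod>b\<in>(Basis :: 'a set). 1 / sqrt (1 - 2 * c b))"
  proof (rule std_gaussian_mgf_axes)
    show "2 * c b < 1" for b :: 'a
    proof (cases "b \<in> \<beta> ` {..<m}")
      case True then show ?thesis using c\<beta> a by auto
    qed (simp add: c_def)
  qed
  finally show ?thesis unfolding pr .
qed

section \<open>Chernoff bounds for traceless quadratic forms\<close>

lemma prod_inverse_sqrt_le_exp:
  fixes x :: "nat \<Rightarrow> real"
  assumes "(\<Sum>i<m. x i) = 0" "(\<Sum>i<m. (x i)\<^sup>2) \<le> 1 / 4"
  shows "(\<Prod>i<m. 1 / sqrt (1 - x i)) \<le> exp (1 / 4)"
    and "\<And>i. i < m \<Longrightarrow> \<bar>x i\<bar> \<le> 1 / 2"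
proof -
  show x: "\<bar>x i\<bar> \<le> 1 / 2" if "i < m" for i
  proof -
    have "(x i)\<^sup>2 \<le> (\<Sum>i<m. (x i)\<^sup>2)" using that by (intro member_le_sum) auto
    also have "\<dots> \<le> (1 / 2)\<^sup>2" using assms(2) by (simp add: power2_eq_square)
    finally show ?thesis using abs_le_square_iff[of "x i" "1 / 2"] by simp
  qed
  \<comment> \<open>This is half of \<open>ln (1 - x) \<ge> - x - 2 * x\<^sup>2\<close>, valid for
    \<open>\<bar>x\<bar> \<le> 1 / 2\<close>. In the product the linear terms cancel because they
    sum to 0, and the squares cost at most \<open>1 / 4\<close>.\<close>
  have "1 / sqrt (1 - x i) \<le> exp (x i / 2 + (x i)\<^sup>2)" if "i < m" for i
  proof -
    have "\<bar>ln (1 + - x i) - - x i\<bar> \<le> 2 * (- x i)\<^sup>2"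
      using x[OF that] by (intro abs_ln_one_plus_x_minus_x_bound) simp
    then have "- (x i / 2 + (x i)\<^sup>2) \<le> ln (sqrt (1 - x i))"
      using x[OF that] by (simp add: ln_sqrt abs_le_iff)
    then have "exp (- (x i / 2 + (x i)\<^sup>2)) \<le> sqrt (1 - x i)"
      using x[OF that] by (simp add: ln_ge_iff abs_le_iff)
    then have "inverse (sqrt (1 - x i)) \<le> inverse (exp (- (x i / 2 + (x i)\<^sup>2)))"
      by (intro le_imp_inverse_le) auto
    also have "\<dots> = exp (x i / 2 + (x i)\<^sup>2)" by (simp only: exp_minus inverse_inverse_eq)
    finally show ?thesis by (simp add: inverse_eq_divide)
  qed
  then have "(\<Prod>i<m. 1 / sqrt (1 - x i)) \<le> (\<Prod>i<m. exp (x i / 2 + (x i)\<^sup>2))"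
    using x by (intro prod_mono) (force simp: abs_le_iff)
  also have "\<dots> = exp ((\<Sum>i<m. x i) / 2 + (\<Sum>i<m. (x i)\<^sup>2))"
    by (simp add: exp_sum[symmetric] sum.distrib sum_divide_distrib)
  also have "\<dots> \<le> exp (1 / 4)" using assms by simp
  finally show "(\<Prod>i<m. 1 / sqrt (1 - x i)) \<le> exp (1 / 4)" .
qed

text \<open>The bound \<open>1 / 16\<close> lets \<open>2 * a i\<close> satisfy the hypotheses of
  \<open>prod_inverse_sqrt_le_exp\<close>, whose second conclusion keeps the exponents in the range
  where the generating function is finite.\<close>

lemma std_gaussian_traceless_mgf:
  fixes e :: "nat \<Rightarrow> 'a::euclidean_space"
  assumes e: "orthonormal_system m e" and a: "(\<Sum>i<m. a i) = 0" "(\<Sum>i<m. (a i)\<^sup>2) \<le> 1 / 16"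
  shows "(\<integral>\<^sup>+g. ennreal (exp (\<Sum>i<m. a i * (g \<bullet> e i)\<^sup>2)) \<partial>std_gaussian) \<le> ennreal (exp (1 / 4))"
proof -
  have s: "(\<Sum>i<m. 2 * a i) = 0" "(\<Sum>i<m. (2 * a i)\<^sup>2) \<le> 1 / 4"
    using a by (simp_all add: power_mult_distrib flip: sum_distrib_left)
  have "2 * a i < 1" if "i < m" for i using prod_inverse_sqrt_le_exp(2)[OF s that] by simp
  then show ?thesis
    using prod_inverse_sqrt_le_exp(1)[OF s] by (subst std_gaussian_mgf[OF e]) (auto intro: ennreal_leI)
qed

text \<open>Absorbs the two one-sided tails, each with constant \<open>exp (1 / 4)\<close>, into the
  constant 3 of the theorem.\<close>

lemma exp_quarter_less: "2 * exp (1 / 4) \<le> (3 :: real)"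
proof -
  have "exp (1 / 4 :: real) ^ 4 = exp 1" by (simp flip: exp_of_nat_mult)
  also have "\<dots> \<le> 3" by (rule exp_le)
  also have "\<dots> \<le> (3 / 2) ^ 4" by (simp add: power_divide)
  finally have "exp (1 / 4 :: real) \<le> 3 / 2" by (rule power_le_imp_le_base[of _ 3, simplified]) simp
  then show ?thesis by simp
qed

text \<open>The factor per dimension in the Chernoff bound for a squared norm below
  \<open>m / 2\<close>. It amounts to \<open>exp (1 / 3) \<le> sqrt 2\<close>, that is,
  \<open>exp 2 \<le> 8\<close>.\<close>

lemma exp_quarter_le_sqrt2: "exp (1 / 4) / sqrt 2 \<le> exp (- 1 / 12 :: real)"
proof -
  have "exp (1 / 3 :: real) ^ 6 = exp 1 ^ 2" by (simp flip: exp_of_nat_mult)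
  also have "\<dots> \<le> (2.72 :: real) ^ 2" using e_less_272 by (intro power_mono) auto
  also have "\<dots> \<le> sqrt 2 ^ 6" by (simp add: power2_eq_square eval_nat_numeral)
  finally have "exp (1 / 3 :: real) \<le> sqrt 2" by (rule power_le_imp_le_base[of _ 5, simplified]) simp
  moreover have "exp (1 / 4 :: real) = exp (1 / 3) * exp (- 1 / 12)" by (simp flip: exp_add)
  ultimately show ?thesis by (simp add: field_simps)
qed

text \<open>The threshold carries the squared length of the projection of \<open>g\<close> to the
  span of \<open>e\<close>, so the event is invariant under scaling and passes to normalized
  vectors. Its indicator is dominated pointwise by three exponentials.\<close>

lemma std_gaussian_traceless_form_tail:
  fixes e :: "nat \<Rightarrow> 'a::euclidean_space"
  assumes e: "orthonormal_system m e" and "0 < m" "0 < s" "0 < t"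
    and lam: "(\<Sum>i<m. lam i) = 0" "(\<Sum>i<m. (lam i)\<^sup>2) \<le> s\<^sup>2"
  shows "(\<integral>\<^sup>+g. indicator {g. t * s / sqrt m * (\<Sum>i<m. (g \<bullet> e i)\<^sup>2) < \<bar>\<Sum>i<m. lam i * (g \<bullet> e i)\<^sup>2\<bar>} g \<partial>std_gaussian)
    \<le> ennreal (3 * exp (- (t * sqrt m / 8)) + exp (- (m / 12)))"
proof -
  define X where "X = (\<lambda>g. \<Sum>i<m. lam i * (g \<bullet> e i)\<^sup>2)"
  define Y where "Y = (\<lambda>g. \<Sum>i<m. (g \<bullet> e i)\<^sup>2)"
  \<comment> \<open>Division by \<open>4 * s\<close> brings the sum of squares down to
    \<open>1 / 16\<close>.\<close>
  define a where "a = (\<lambda>i. lam i / (4 * s))"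
  define c where "c = exp (- (t * sqrt m / 8))"
  have aX: "(\<Sum>i<m. a i * (g \<bullet> e i)\<^sup>2) = X g / (4 * s)" "(\<Sum>i<m. - a i * (g \<bullet> e i)\<^sup>2) = - (X g / (4 * s))" for g
    by (simp_all add: X_def a_def sum_divide_distrib sum_negf)
  have a: "(\<Sum>i<m. a i) = 0" "(\<Sum>i<m. (a i)\<^sup>2) \<le> 1 / 16"
    using lam \<open>0 < s\<close> by (simp_all add: a_def power_divide power_mult_distrib flip: sum_divide_distrib)
  have bound: "indicator {g. t * s / sqrt m * Y g < \<bar>X g\<bar>} g \<le>
      ennreal (c * exp (X g / (4 * s))) + ennreal (c * exp (- (X g / (4 * s))))
       + ennreal (exp (m / 4) * exp (- Y g / 2))" (is "?l \<le> ?r1 + ?r2 + ?r3") for g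
  proof (cases "t * s / sqrt m * Y g < \<bar>X g\<bar>")
    case True
    consider "Y g < m / 2" | "m / 2 \<le> Y g" by linarith
    then show ?thesis
    proof cases
      case 1
      then have "1 \<le> exp (m / 4) * exp (- Y g / 2)" by (simp flip: exp_add)
      then have "1 \<le> ?r3" by (simp add: ennreal_leI flip: ennreal_1)
      also have "\<dots> \<le> ?r1 + ?r2 + ?r3" by simp
      finally show ?thesis using True by simp
    next
      case 2
      \<comment> \<open>Once \<open>Y g\<close> is at least \<open>m / 2\<close>, the threshold is
        at least \<open>t * s * sqrt m / 2\<close>; dividing by \<open>4 * s\<close> gives the
        exponent in \<open>c\<close>.\<close>
      have "t * sqrt m * s / 2 = t * s / sqrt m * (m / 2)"
        using real_sqrt_mult_self[of m] \<open>0 < m\<close> by (simp add: field_simps)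
      also have "\<dots> \<le> t * s / sqrt m * Y g" using 2 assms by (intro mult_left_mono) auto
      also note True
      finally have "t * sqrt m / 8 < \<bar>X g\<bar> / (4 * s)" using \<open>0 < s\<close> by (simp add: field_simps)
      then have "1 \<le> c * exp (X g / (4 * s)) \<or> 1 \<le> c * exp (- (X g / (4 * s)))"
        unfolding c_def by (cases "0 \<le> X g") (simp_all flip: exp_add)
      then have "1 \<le> ?r1 \<or> 1 \<le> ?r2" by (auto simp: ennreal_leI simp flip: ennreal_1)
      then have "1 \<le> ?r1 + ?r2" by (meson add_increasing add_increasing2 zero_le)
      also have "\<dots> \<le> ?r1 + ?r2 + ?r3" by simp
      finally show ?thesis using True by simp
    qed
  qed simp
  have [measurable]: "X \<in> borel_measurable borel" "Y \<in> borel_measurable borel"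
    by (auto simp: X_def[abs_def] Y_def[abs_def])
  have i1: "(\<integral>\<^sup>+g. ennreal (c * exp (X g / (4 * s))) \<partial>std_gaussian) \<le> ennreal (c * exp (1 / 4))"
    using std_gaussian_traceless_mgf[OF e a] unfolding aX
    by (simp add: ennreal_mult nn_integral_cmult c_def mult_left_mono)
  have i2: "(\<integral>\<^sup>+g. ennreal (c * exp (- (X g / (4 * s)))) \<partial>std_gaussian) \<le> ennreal (c * exp (1 / 4))"
    using std_gaussian_traceless_mgf[OF e, of "\<lambda>i. - a i"] a unfolding aX
    by (simp add: ennreal_mult nn_integral_cmult c_def mult_left_mono sum_negf)
  \<comment> \<open>Coefficient \<open>- 1 / 2\<close> in every direction gives a factor
    \<open>1 / sqrt 2\<close> per dimension.\<close>
  have "(\<integral>\<^sup>+g. ennreal (exp (m / 4) * exp (- Y g / 2)) \<partial>std_gaussian)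
    = ennreal (exp (m / 4)) * (\<integral>\<^sup>+g. ennreal (exp (\<Sum>i<m. (- 1 / 2) * (g \<bullet> e i)\<^sup>2)) \<partial>std_gaussian)"
    by (simp add: ennreal_mult nn_integral_cmult Y_def sum_negf sum_divide_distrib)
  also have "\<dots> = ennreal (exp (m / 4)) * ennreal ((1 / sqrt 2) ^ m)"
    by (subst std_gaussian_mgf[OF e]) auto
  also have "\<dots> = ennreal ((exp (1 / 4) / sqrt 2) ^ m)"
    by (simp add: ennreal_mult[symmetric] power_divide flip: exp_of_nat_mult)
  also have "\<dots> \<le> ennreal (exp (- 1 / 12) ^ m)"
    by (intro ennreal_leI power_mono exp_quarter_le_sqrt2) auto
  also have "\<dots> = ennreal (exp (- (m / 12)))" by (simp flip: exp_of_nat_mult)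
  finally have i3: "(\<integral>\<^sup>+g. ennreal (exp (m / 4) * exp (- Y g / 2)) \<partial>std_gaussian) \<le> ennreal (exp (- (m / 12)))" .
  have "(\<integral>\<^sup>+g. indicator {g. t * s / sqrt m * Y g < \<bar>X g\<bar>} g \<partial>std_gaussian)
     \<le> (\<integral>\<^sup>+g. ennreal (c * exp (X g / (4 * s))) + ennreal (c * exp (- (X g / (4 * s))))
       + ennreal (exp (m / 4) * exp (- Y g / 2)) \<partial>std_gaussian)"
    by (intro nn_integral_mono bound)
  also have "\<dots> \<le> ennreal (c * exp (1 / 4)) + ennreal (c * exp (1 / 4)) + ennreal (exp (- (m / 12)))"
    using i1 i2 i3 by (simp add: nn_integral_add add_mono)
  also have "\<dots> = ennreal (c * (2 * exp (1 / 4)) + exp (- (m / 12)))"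
    by (simp add: c_def ennreal_plus[symmetric] del: ennreal_plus)
  also have "\<dots> \<le> ennreal (3 * c + exp (- (m / 12)))"
    using mult_left_mono[OF exp_quarter_less, of c] by (intro ennreal_leI) (simp add: c_def)
  finally show ?thesis by (simp add: X_def Y_def c_def)
qed

subsection \<open>Invariance of Haar measure\<close>

lemma orthogonal_groupD:
  "Q \<in> orthogonal_group m \<Longrightarrow> i < m \<Longrightarrow> j < m \<Longrightarrow> (\<Sum>k<m. Q (k, i) * Q (k, j)) = (if i = j then 1 else 0)"
  by (auto simp: orthogonal_group_def)

text \<open>
  Put \<open>D = I - Q Q\<^sup>T\<close>. Orthonormality of the columns gives that row \<open>i\<close> of \<open>D\<close> has square norm
  \<open>1 - (\<Sum>k. Q(i,k)\<^sup>2)\<close>, and these numbers add up to \<open>m - m = 0\<close>.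
\<close>

lemma orthogonal_group_rows:
  assumes Q: "Q \<in> orthogonal_group m" and "i < m" "j < m"
  shows "(\<Sum>k<m. Q (i, k) * Q (j, k)) = (if i = j then 1 else 0)"
proof -
  define D where "D = (\<lambda>i l. (if i = l then 1 else 0) - (\<Sum>k<m. Q (i, k) * Q (l, k)))"
  have row: "(\<Sum>l<m. (D i l)\<^sup>2) = 1 - (\<Sum>k<m. (Q (i, k))\<^sup>2)" if "i < m" for i
  proof -
    have "(\<Sum>l<m. (\<Sum>k<m. Q (i, k) * Q (l, k))\<^sup>2)
      = (\<Sum>l<m. \<Sum>k<m. \<Sum>k'<m. Q (i, k) * Q (i, k') * (Q (l, k) * Q (l, k')))"
      by (simp add: power2_eq_square sum_product mult_ac)
    also have "\<dots> = (\<Sum>k<m. \<Sum>l<m. \<Sum>k'<m. Q (i, k) * Q (i, k') * (Q (l, k) * Q (l, k')))"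
      by (rule sum.swap)
    also have "\<dots> = (\<Sum>k<m. \<Sum>k'<m. \<Sum>l<m. Q (i, k) * Q (i, k') * (Q (l, k) * Q (l, k')))"
      by (intro sum.cong refl sum.swap)
    also have "\<dots> = (\<Sum>k<m. \<Sum>k'<m. Q (i, k) * Q (i, k') * (if k = k' then 1 else 0))"
      by (intro sum.cong refl) (simp add: orthogonal_groupD[OF Q] flip: sum_distrib_left)
    also have "\<dots> = (\<Sum>k<m. (Q (i, k))\<^sup>2)"
      by (simp add: power2_eq_square if_distrib[of "\<lambda>x. _ * x"] cong: if_cong)
    finally have sq: "(\<Sum>l<m. (\<Sum>k<m. Q (i, k) * Q (l, k))\<^sup>2) = (\<Sum>k<m. (Q (i, k))\<^sup>2)" .
    have "(D i l)\<^sup>2 = (if i = l then 1 - 2 * (\<Sum>k<m. (Q (i, k))\<^sup>2) else 0)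
        + (\<Sum>k<m. Q (i, k) * Q (l, k))\<^sup>2" for l
      by (simp add: D_def power2_eq_square algebra_simps)
    then show ?thesis using that by (simp add: sum.distrib sq)
  qed
  have "(\<Sum>i<m. \<Sum>k<m. (Q (i, k))\<^sup>2) = (\<Sum>k<m. \<Sum>i<m. Q (i, k) * Q (i, k))"
    by (subst sum.swap) (simp add: power2_eq_square)
  also have "\<dots> = m" by (simp add: orthogonal_groupD[OF Q])
  finally have "(\<Sum>i<m. \<Sum>l<m. (D i l)\<^sup>2) = 0" by (simp add: row sum_subtractf)
  then have "\<forall>i<m. \<forall>l<m. D i l = 0" by (simp add: sum_nonneg_eq_0_iff sum_nonneg)
  then have "D i j = 0" using assms by blast
  then show ?thesis by (simp add: D_def)
qed

definition sqmat_transpose :: "nat \<Rightarrow> sqmat \<Rightarrow> sqmat" where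
  "sqmat_transpose m Q = (\<lambda>(i, j) \<in> {..<m} \<times> {..<m}. Q (j, i))"

lemma sqmat_transpose_orthogonal:
  "Q \<in> orthogonal_group m \<Longrightarrow> sqmat_transpose m Q \<in> orthogonal_group m"
  using orthogonal_group_rows[of Q m] by (auto simp: orthogonal_group_def[of m] sqmat_transpose_def)

text \<open>Entrywise \<open>Q^T (R^T R) Q = Q^T Q\<close>: the sum over the rows of
  \<open>R\<close> is moved innermost, where orthonormality of the columns of \<open>R\<close>
  collapses it.\<close>

lemma sqmat_mult_orthogonal:
  assumes R: "R \<in> orthogonal_group m" and Q: "Q \<in> orthogonal_group m"
  shows "sqmat_mult m R Q \<in> orthogonal_group m"
proof -
  have "(\<Sum>k<m. sqmat_mult m R Q (k, i) * sqmat_mult m R Q (k, j)) = (if i = j then 1 else 0)"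
    if "i < m" "j < m" for i j
  proof -
    have "(\<Sum>k<m. sqmat_mult m R Q (k, i) * sqmat_mult m R Q (k, j))
      = (\<Sum>k<m. \<Sum>a<m. \<Sum>b<m. Q (a, i) * Q (b, j) * (R (k, a) * R (k, b)))"
      using that by (simp add: sqmat_mult_def sum_product mult_ac)
    also have "\<dots> = (\<Sum>a<m. \<Sum>k<m. \<Sum>b<m. Q (a, i) * Q (b, j) * (R (k, a) * R (k, b)))"
      by (rule sum.swap)
    also have "\<dots> = (\<Sum>a<m. \<Sum>b<m. \<Sum>k<m. Q (a, i) * Q (b, j) * (R (k, a) * R (k, b)))"
      by (intro sum.cong refl sum.swap)
    also have "\<dots> = (\<Sum>a<m. \<Sum>b<m. Q (a, i) * Q (b, j) * (if a = b then 1 else 0))"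
      by (intro sum.cong refl) (simp add: orthogonal_groupD[OF R] flip: sum_distrib_left)
    also have "\<dots> = (\<Sum>a<m. Q (a, i) * Q (a, j))"
      by (simp add: if_distrib[of "\<lambda>x. _ * x"] cong: if_cong)
    finally show ?thesis using orthogonal_groupD[OF Q that] by simp
  qed
  then show ?thesis by (auto simp: orthogonal_group_def sqmat_mult_def[of m R Q])
qed

text \<open>The Householder reflection exchanging \<open>v\<close> and the \<open>j\<close>-th axis; its vector \<open>w = e\<^sub>j - v\<close>
  satisfies \<open>|w|\<^sup>2 = 2 w\<^sub>j\<close>. If \<open>w\<^sub>j = 0\<close>, the division by zero correctly yields the identity.\<close>

lemma orthogonal_group_prescribed_row:
  fixes v :: "nat \<Rightarrow> real"
  assumes v: "(\<Sum>k<m. (v k)\<^sup>2) = 1" and j: "j < m"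
  obtains S where "S \<in> orthogonal_group m" "\<And>k. k < m \<Longrightarrow> S (j, k) = v k"
proof -
  define d :: "nat \<Rightarrow> nat \<Rightarrow> real" where "d = (\<lambda>i k. if i = k then 1 else 0)"
  define w where "w = (\<lambda>k. d j k - v k)"
  have "(w k)\<^sup>2 = (if k = j then 1 - 2 * v j else 0) + (v k)\<^sup>2" for k
    by (simp add: w_def d_def power2_eq_square algebra_simps)
  then have w2: "(\<Sum>k<m. (w k)\<^sup>2) = 2 * w j" using j by (simp add: sum.distrib v w_def d_def)
  have w0: "w k = 0" if "w j = 0" "k < m" for k
    using w2 that by (simp add: sum_nonneg_eq_0_iff)
  \<comment> \<open>The Householder coefficient \<open>2 / |w|^2\<close>. The identity
    \<open>r\<^sup>2 * w j = r\<close> survives \<open>w j = 0\<close>, since then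
    \<open>r = 0\<close>.\<close>
  define r where "r = 1 / w j"
  have r: "r\<^sup>2 * w j = r" by (simp add: r_def power2_eq_square)
  define S where "S = (\<lambda>(i, k) \<in> {..<m} \<times> {..<m}. d i k - r * w i * w k)"
  have "(\<Sum>k<m. S (k, a) * S (k, b)) = d a b" if ab: "a < m" "b < m" for a b
  proof -
    have "S (k, a) * S (k, b) = (if k = a then d a b else 0) - (if k = a then r * w a * w b else 0)
      - (if k = b then r * w a * w b else 0) + r\<^sup>2 * w a * w b * (w k)\<^sup>2" if "k < m" for k
      using ab that by (auto simp: S_def d_def power2_eq_square algebra_simps)
    then have "(\<Sum>k<m. S (k, a) * S (k, b)) = d a b - 2 * (r * w a * w b) + r\<^sup>2 * w a * w b * (2 * w j)"
      using ab by (simp add: sum.distrib sum_subtractf w2 flip: sum_distrib_left)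
    also have "\<dots> = d a b - 2 * (r * w a * w b) + 2 * (r\<^sup>2 * w j) * w a * w b" by simp
    also have "\<dots> = d a b" unfolding r by simp
    finally show ?thesis .
  qed
  then have "S \<in> orthogonal_group m" by (auto simp: orthogonal_group_def S_def d_def)
  moreover have "S (j, k) = v k" if "k < m" for k
    using w0[OF _ that] that j by (cases "w j = 0") (auto simp: S_def w_def r_def)
  ultimately show ?thesis using that by blast
qed

section \<open>The law of a column of a Haar random matrix\<close>

definition sqmat_col :: "nat \<Rightarrow> sqmat \<Rightarrow> nat \<Rightarrow> nat \<Rightarrow> real" where
  "sqmat_col m Q j = (\<lambda>i\<in>{..<m}. Q (i, j))"

text \<open>Restricted to \<open>{..<m}\<close> so that its values lie in the product space on which
  the test functions \<open>h\<close> below are measurable.\<close>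

definition transpose_apply :: "nat \<Rightarrow> sqmat \<Rightarrow> (nat \<Rightarrow> real) \<Rightarrow> nat \<Rightarrow> real" where
  "transpose_apply m R v = (\<lambda>i\<in>{..<m}. \<Sum>k<m. R (k, i) * v k)"

locale haar_group =
  fixes m :: nat and H :: "sqmat measure"
  assumes haar: "haar_probability m H"
begin

sublocale prob_space H
  using haar by (simp add: haar_probability_def)

lemma sets_H [measurable_cong]: "sets H = sets (orthogonal_group_space m)"
  using haar by (simp add: haar_probability_def)

lemma space_H: "space H = orthogonal_group m"
proof -
  have "space H = space (orthogonal_group_space m)" by (rule sets_eq_imp_space_eq[OF sets_H])
  then show ?thesis by (auto simp: orthogonal_group_space_def space_restrict_space space_PiM orthogonal_group_def)
qed

lemma entry_measurable [measurable]:
  assumes "i < m" "j < m"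
  shows "(\<lambda>Q. Q (i, j)) \<in> borel_measurable H"
proof -
  have "(\<lambda>Q. Q (i, j)) \<in> borel_measurable (orthogonal_group_space m)"
    unfolding orthogonal_group_space_def using assms
    by (intro measurable_restrict_space1 measurable_component_singleton) auto
  then show ?thesis by (simp cong: measurable_cong_sets add: sets_H)
qed

lemma nn_integral_left_mult:
  assumes R: "R \<in> orthogonal_group m" and F[measurable]: "F \<in> borel_measurable H"
  shows "(\<integral>\<^sup>+Q. F (sqmat_mult m R Q) \<partial>H) = (\<integral>\<^sup>+Q. F Q \<partial>H)"
proof -
  have "sqmat_mult m R \<in> measurable H (orthogonal_group_space m)"
    unfolding orthogonal_group_space_def
  proof (rule measurable_restrict_space2)
    show "sqmat_mult m R \<in> space H \<rightarrow> orthogonal_group m"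
      using R by (auto simp: space_H sqmat_mult_orthogonal)
    show "sqmat_mult m R \<in> measurable H (\<Pi>\<^sub>M p \<in> {..<m} \<times> {..<m}. borel)"
      unfolding sqmat_mult_def
      by (rule measurable_restrict) (auto intro!: borel_measurable_sum borel_measurable_times)
  qed
  then have "sqmat_mult m R \<in> measurable H H"
    by (simp cong: measurable_cong_sets add: sets_H)
  moreover have "distr H H (sqmat_mult m R) = H" using haar R by (simp add: haar_probability_def)
  ultimately show ?thesis using nn_integral_distr[of "sqmat_mult m R" H H F] F by simp
qed

text \<open>
  Haar measure is only assumed to be left invariant. The left side is independent of the unit
  vector \<open>v\<close>; averaging it over \<open>v = Q e\<^sub>j\<close> and applying left invariance to \<open>R\<^sup>T Q\<close> for fixed \<open>R\<close>
  identifies it with the law of a column.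
\<close>

lemma nn_integral_transpose_apply:
  assumes h[measurable]: "h \<in> borel_measurable (\<Pi>\<^sub>M i \<in> {..<m}. borel)"
    and v: "(\<Sum>k<m. (v k)\<^sup>2) = 1" and j: "j < m"
  shows "(\<integral>\<^sup>+R. h (transpose_apply m R v) \<partial>H) = (\<integral>\<^sup>+Q. h (sqmat_col m Q j) \<partial>H)"
proof -
  define p where "p = (\<integral>\<^sup>+R. h (\<lambda>i\<in>{..<m}. R (j, i)) \<partial>H)"
  \<comment> \<open>If \<open>v\<close> is row \<open>j\<close> of an orthogonal \<open>S\<close>,
    then \<open>R^T v\<close> is row \<open>j\<close> of \<open>S R\<close>, which has the same law
    as row \<open>j\<close> of \<open>R\<close> by left invariance.\<close>
  have row: "(\<integral>\<^sup>+R. h (transpose_apply m R v) \<partial>H) = p" if v: "(\<Sum>k<m. (v k)\<^sup>2) = 1" for v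
  proof -
    obtain S where S: "S \<in> orthogonal_group m" "\<And>k. k < m \<Longrightarrow> S (j, k) = v k"
      using orthogonal_group_prescribed_row[OF v j] by metis
    have "transpose_apply m R v = (\<lambda>i\<in>{..<m}. sqmat_mult m S R (j, i))" for R
      using j by (auto simp: transpose_apply_def sqmat_mult_def S mult.commute intro!: restrict_ext sum.cong)
    moreover have "(\<lambda>R. h (\<lambda>i\<in>{..<m}. R (j, i))) \<in> borel_measurable H"
      using j by (intro measurable_compose[OF measurable_restrict h]) auto
    ultimately show ?thesis using nn_integral_left_mult[OF S(1)] by (simp add: p_def)
  qed
  have colm: "(\<lambda>Q. h (sqmat_col m Q j)) \<in> borel_measurable H"
    unfolding sqmat_col_def using j by (intro measurable_compose[OF measurable_restrict h]) auto
  interpret P: pair_prob_space H H ..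
  have "(\<integral>\<^sup>+Q. h (sqmat_col m Q j) \<partial>H) = (\<integral>\<^sup>+R. (\<integral>\<^sup>+Q. h (sqmat_col m Q j) \<partial>H) \<partial>H)"
    by (simp add: emeasure_space_1)
  also have "\<dots> = (\<integral>\<^sup>+R. (\<integral>\<^sup>+Q. h (transpose_apply m R (sqmat_col m Q j)) \<partial>H) \<partial>H)"
  proof (rule nn_integral_cong)
    fix R assume "R \<in> space H"
    then have R: "sqmat_transpose m R \<in> orthogonal_group m"
      by (simp add: space_H sqmat_transpose_orthogonal)
    have "transpose_apply m R (sqmat_col m Q j) = sqmat_col m (sqmat_mult m (sqmat_transpose m R) Q) j" for Q
      using j by (auto simp: transpose_apply_def sqmat_col_def sqmat_mult_def sqmat_transpose_def intro!: restrict_ext sum.cong)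
    then show "(\<integral>\<^sup>+Q. h (sqmat_col m Q j) \<partial>H) = (\<integral>\<^sup>+Q. h (transpose_apply m R (sqmat_col m Q j)) \<partial>H)"
      using nn_integral_left_mult[OF R colm] by simp
  qed
  also have "\<dots> = (\<integral>\<^sup>+Q. (\<integral>\<^sup>+R. h (transpose_apply m R (sqmat_col m Q j)) \<partial>H) \<partial>H)"
  proof (rule P.Fubini')
    have "(\<lambda>x. h (transpose_apply m (fst x) (sqmat_col m (snd x) j))) \<in> borel_measurable (H \<Otimes>\<^sub>M H)"
      unfolding transpose_apply_def sqmat_col_def using j
      by (intro measurable_compose[OF measurable_restrict h]) (auto intro!: borel_measurable_sum borel_measurable_times
         measurable_compose[OF measurable_fst] measurable_compose[OF measurable_snd] entry_measurable)
    from measurable_compose[OF measurable_pair_swap' this]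
    show "(\<lambda>(Q, R). h (transpose_apply m R (sqmat_col m Q j))) \<in> borel_measurable (H \<Otimes>\<^sub>M H)"
      by (simp add: case_prod_beta')
  qed
  also have "\<dots> = (\<integral>\<^sup>+Q. p \<partial>H)"
  proof (rule nn_integral_cong)
    fix Q assume "Q \<in> space H"
    then have "(\<Sum>k<m. (sqmat_col m Q j k)\<^sup>2) = 1"
      using j orthogonal_groupD[of Q m j j] by (simp add: space_H sqmat_col_def power2_eq_square)
    then show "(\<integral>\<^sup>+R. h (transpose_apply m R (sqmat_col m Q j)) \<partial>H) = p" by (rule row)
  qed
  also have "\<dots> = p" by (simp add: emeasure_space_1)
  finally show ?thesis using row[OF v] by simp
qed

end

subsection \<open>Quadratic forms on subspaces\<close>

text \<open>As \<open>orthonormal_bases\<close>, but without extensionality, so that bases can be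
  modified and combined as plain functions.\<close>

definition orthonormal_basis_of :: "'a::euclidean_space set \<Rightarrow> nat \<Rightarrow> (nat \<Rightarrow> 'a) \<Rightarrow> bool" where
  "orthonormal_basis_of F m e \<longleftrightarrow> orthonormal_system m e \<and> span (e ` {..<m}) = F"

lemma orthonormal_basis_ofI:
  assumes F: "subspace F" "dim F = m" and e: "orthonormal_system m e" "\<And>i. i < m \<Longrightarrow> e i \<in> F"
  shows "orthonormal_basis_of F m e"
proof -
  have "card (e ` {..<m}) = m" by (simp add: card_image orthonormal_system_inj_on[OF e(1)])
  then have "F \<subseteq> span (e ` {..<m})"
    using F e(2) by (intro card_ge_dim_independent orthonormal_system_independent[OF e(1)]) auto
  moreover have "span (e ` {..<m}) \<subseteq> F" using F(1) e(2) by (intro span_minimal) auto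
  ultimately show ?thesis using e(1) by (simp add: orthonormal_basis_of_def)
qed

lemma orthonormal_basis_of_expand:
  assumes e: "orthonormal_basis_of F m e" and u: "u \<in> F"
  shows "u = (\<Sum>i<m. (u \<bullet> e i) *\<^sub>R e i)"
proof -
  let ?p = "\<lambda>u. \<Sum>i<m. (u \<bullet> e i) *\<^sub>R e i"
  have o: "orthonormal_system m e" and us: "u \<in> span (e ` {..<m})"
    using e u by (auto simp: orthonormal_basis_of_def)
  from us show ?thesis
  proof (induction rule: span_induct)
    case base
    show ?case unfolding subspace_def by (auto simp: inner_add_left scaleR_add_left sum.distrib simp flip: scaleR_scaleR scaleR_sum_right)
  next
    case (step x)
    then obtain j where j: "j < m" "x = e j" by auto
    have "?p x = (\<Sum>i<m. if i = j then e j else 0)"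
      using j by (intro sum.cong) (auto simp: orthonormal_systemD[OF o])
    then show ?case using j by simp
  qed
qed

text \<open>Parseval's identity; \<open>d\<close> may lie outside \<open>F\<close>, since its
  component orthogonal to \<open>F\<close> does not contribute.\<close>

lemma orthonormal_basis_of_inner:
  assumes e: "orthonormal_basis_of F m e" and u: "u \<in> F"
  shows "d \<bullet> u = (\<Sum>i<m. (d \<bullet> e i) * (u \<bullet> e i))"
  by (subst orthonormal_basis_of_expand[OF e u]) (simp add: inner_sum_right mult.commute)

lemma orthonormal_basis_of_mem: "orthonormal_basis_of F m e \<Longrightarrow> i < m \<Longrightarrow> e i \<in> F"
  by (auto simp: orthonormal_basis_of_def intro: span_base)

lemma orthonormal_basis_of_sum_mem: "orthonormal_basis_of F m e \<Longrightarrow> (\<Sum>i<m. c i *\<^sub>R e i) \<in> F"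
  unfolding orthonormal_basis_of_def by (clarify, intro span_sum span_scale span_base) auto

text \<open>Both sides are the square norm of the orthogonal projection of \<open>d\<close> to \<open>F\<close>.\<close>

lemma orthonormal_basis_of_sum_squares_eq:
  assumes e: "orthonormal_basis_of F m e" and e': "orthonormal_basis_of F m e'"
  shows "(\<Sum>i<m. (d \<bullet> e i)\<^sup>2) = (\<Sum>i<m. (d \<bullet> e' i)\<^sup>2)"
proof -
  define p where "p = (\<Sum>i<m. (d \<bullet> e i) *\<^sub>R e i)"
  have p: "p \<in> F" unfolding p_def by (rule orthonormal_basis_of_sum_mem[OF e])
  have dp: "p \<bullet> u = d \<bullet> u" if "u \<in> F" for u
    using orthonormal_basis_of_inner[OF e that, of d] by (simp add: p_def inner_sum_left inner_commute[of u])
  have "(\<Sum>i<m. (d \<bullet> b i)\<^sup>2) = p \<bullet> p" if b: "orthonormal_basis_of F m b" for b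
    using orthonormal_basis_of_inner[OF b p, of p] dp[OF orthonormal_basis_of_mem[OF b]]
    by (simp add: power2_eq_square)
  then show ?thesis using e e' by simp
qed

text \<open>The spectral theorem for the compression of \<open>T\<close> to \<open>F\<close>, which
  \<open>T\<close> need not preserve. One vector maximizes the Rayleigh quotient on the unit sphere
  of \<open>F\<close>; the others come from the induction hypothesis on its orthogonal complement in
  \<open>F\<close>.\<close>

lemma orthonormal_diagonalization:
  fixes T :: "'a::euclidean_space \<Rightarrow> 'a"
  assumes T: "linear T" and sym: "\<And>x y. x \<bullet> T y = y \<bullet> T x"
  shows "subspace F \<Longrightarrow> dim F = m \<Longrightarrow>
    \<exists>e. orthonormal_basis_of F m e \<and> (\<forall>i<m. \<forall>j<m. i \<noteq> j \<longrightarrow> e i \<bullet> T (e j) = 0)"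
proof (induction m arbitrary: F)
  case 0
  then show ?case by (intro exI[of _ "\<lambda>_. 0"]) (auto intro!: orthonormal_basis_ofI simp: orthonormal_system_def)
next
  case (Suc m)
  let ?S = "F \<inter> sphere 0 1"
  obtain z where z: "z \<in> F" "z \<noteq> 0" using Suc.prems(2) by (metis dim_eq_0 nat.distinct(1) subsetI singletonI)
  then have "z /\<^sub>R norm z \<in> ?S" using Suc.prems(1) by (simp add: subspace_scale)
  moreover have "compact ?S" using closed_subspace[OF Suc.prems(1)] by (simp add: closed_Int_compact)
  moreover have "continuous_on ?S (\<lambda>u. u \<bullet> T u)"
    using T by (intro continuous_intros linear_continuous_on) (simp add: linear_linear)
  ultimately obtain a where a: "a \<in> ?S" and max: "\<And>u. u \<in> ?S \<Longrightarrow> u \<bullet> T u \<le> a \<bullet> T a"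
    using continuous_attains_sup[of ?S "\<lambda>u. u \<bullet> T u"] by blast
  define l where "l = a \<bullet> T a"
  have aa: "a \<in> F" "a \<bullet> a = 1" using a by (auto simp: norm_eq_1)
  have le: "u \<bullet> T u \<le> l * (u \<bullet> u)" if u: "u \<in> F" for u
  proof (cases "u = 0")
    case False
    let ?v = "u /\<^sub>R norm u"
    have "?v \<bullet> T ?v \<le> l" using max[of ?v] u False Suc.prems(1) by (simp add: l_def subspace_scale)
    then have "(u \<bullet> T u) / (norm u)\<^sup>2 \<le> l" using T by (simp add: linear_scale power2_eq_square divide_inverse mult_ac)
    then show ?thesis using False by (simp add: divide_le_eq power2_norm_eq_inner[symmetric])
  qed simp
  have orth: "a \<bullet> T w = 0" if w: "w \<in> F" "a \<bullet> w = 0" for w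
  proof (rule ccontr)
    define \<beta> where "\<beta> = a \<bullet> T w"
    define K where "K = l * (w \<bullet> w) - w \<bullet> T w"
    assume "a \<bullet> T w \<noteq> 0"
    then have \<beta>: "\<beta>\<^sup>2 > 0" by (simp add: \<beta>_def)
    \<comment> \<open>Maximality tested at \<open>a + s w\<close>, of squared norm
      \<open>1 + s^2 (w \<bullet> w)\<close>: the first-order term is dominated by the second-order
      term for every \<open>s\<close>.\<close>
    have quad: "2 * (s * \<beta>) \<le> s\<^sup>2 * K" for s
    proof -
      have "a + s *\<^sub>R w \<in> F" using aa w Suc.prems(1) by (simp add: subspace_add subspace_scale)
      from le[OF this] have "l + 2 * (s * \<beta>) + s\<^sup>2 * (w \<bullet> T w) \<le> l * (1 + s\<^sup>2 * (w \<bullet> w))"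
        using T w aa sym[of w a] unfolding l_def \<beta>_def
        by (simp add: linear_add linear_scale inner_add_left inner_add_right inner_commute[of w a] power2_eq_square algebra_simps)
      then show ?thesis by (simp add: K_def algebra_simps)
    qed
    \<comment> \<open>The choice \<open>s = \<beta> / c\<close> is small enough for the linear term
      to win: \<open>quad\<close> would give \<open>2 * c \<le> K\<close>, while
      \<open>K < c\<close>.\<close>
    define c where "c = \<bar>K\<bar> + 1"
    have c: "c > 0" "K < c" by (auto simp: c_def)
    have "2 * \<beta>\<^sup>2 / c \<le> \<beta>\<^sup>2 * K / c\<^sup>2" using quad[of "\<beta> / c"] by (simp add: power2_eq_square)
    then have "2 * c * \<beta>\<^sup>2 \<le> K * \<beta>\<^sup>2" using c(1) by (simp add: divide_simps power2_eq_square mult_ac)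
    then have "2 * c \<le> K" using \<beta> by simp
    then show False using c by simp
  qed
  define F' where "F' = {w \<in> F. a \<bullet> w = 0}"
  have sub: "subspace F'" using Suc.prems(1) by (auto simp: F'_def subspace_def inner_add_right)
  have "F' = {y \<in> F. \<forall>x\<in>span {a}. orthogonal x y}"
    by (auto simp: F'_def orthogonal_def span_singleton)
  moreover have "dim (span {a}) = 1" using aa by (subst dim_span, subst dim_eq_card_independent) auto
  ultimately have "dim F' = m"
    using dim_subspace_orthogonal_to_vectors[of "span {a}" F] Suc.prems aa span_minimal[of "{a}" F] by auto
  with Suc.IH[OF sub] obtain e where e: "orthonormal_basis_of F' m e"
    and diag: "\<And>i j. i < m \<Longrightarrow> j < m \<Longrightarrow> i \<noteq> j \<Longrightarrow> e i \<bullet> T (e j) = 0" by blast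
  have eF: "e i \<in> F" "a \<bullet> e i = 0" "e i \<bullet> a = 0" if "i < m" for i
    using orthonormal_basis_of_mem[OF e that] by (auto simp: F'_def inner_commute)
  define e' where "e' = e(m := a)"
  have "orthonormal_basis_of F (Suc m) e'"
  proof (rule orthonormal_basis_ofI[OF Suc.prems])
    show "orthonormal_system (Suc m) e'"
      using e aa(2) eF(2,3) by (auto simp: orthonormal_system_def orthonormal_basis_of_def e'_def less_Suc_eq)
    show "e' i \<in> F" if "i < Suc m" for i using that aa eF by (auto simp: e'_def less_Suc_eq)
  qed
  moreover have "\<forall>i<Suc m. \<forall>j<Suc m. i \<noteq> j \<longrightarrow> e' i \<bullet> T (e' j) = 0"
    using diag orth[OF eF(1,2)] sym by (auto simp: e'_def less_Suc_eq)
  ultimately show ?case by blast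
qed

lemma orthogonal_group_combination:
  assumes b: "orthonormal_system m b" and Q: "Q \<in> orthogonal_group m"
  shows "orthonormal_system m (\<lambda>j. \<Sum>i<m. Q (i, j) *\<^sub>R b i)"
proof -
  have "(\<Sum>k<m. Q (k, i) *\<^sub>R b k) \<bullet> (\<Sum>k<m. Q (k, j) *\<^sub>R b k) = (if i = j then 1 else 0)"
    if "i < m" "j < m" for i j
  proof -
    have "(\<Sum>k<m. Q (k, i) *\<^sub>R b k) \<bullet> b k = Q (k, i)" if "k < m" for k
      using that by (simp add: inner_sum_left orthonormal_systemD[OF b] if_distrib cong: if_cong)
    then have "(\<Sum>k<m. Q (k, i) *\<^sub>R b k) \<bullet> (\<Sum>k<m. Q (k, j) *\<^sub>R b k) = (\<Sum>k<m. Q (k, j) * Q (k, i))"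
      by (subst inner_sum_right) simp
    then show ?thesis using orthogonal_groupD[OF Q that] by (simp add: mult.commute)
  qed
  then show ?thesis by (simp add: orthonormal_system_def)
qed

section \<open>From a Haar column to a Gaussian vector\<close>

lemma AE_std_gaussian_inner_nonzero:
  fixes a :: "'a::euclidean_space"
  assumes "a \<noteq> 0"
  shows "AE g in std_gaussian. g \<bullet> a \<noteq> 0"
proof -
  have "negligible {g. a \<bullet> g = 0}" by (rule negligible_hyperplane) (use assms in auto)
  then have "{g. a \<bullet> g = 0} \<in> null_sets lborel"
    by (simp add: negligible_iff_null_sets null_sets_completion_iff)
  then have "AE g in lborel. g \<bullet> a \<noteq> 0"
    by (auto simp: inner_commute[of _ a] intro: AE_I')
  then show ?thesis unfolding std_gaussian_def by (subst AE_density) auto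
qed

context haar_group begin

text \<open>For almost every \<open>g\<close> the coordinates along \<open>b\<close> do not all
  vanish, and dividing them by their norm gives a unit vector to which
  \<open>nn_integral_transpose_apply\<close> applies. Homogeneity of \<open>h\<close> removes the
  division again.\<close>

lemma nn_integral_sqmat_col_gaussian:
  fixes b :: "nat \<Rightarrow> 'a::euclidean_space"
  assumes h[measurable]: "h \<in> borel_measurable (\<Pi>\<^sub>M i \<in> {..<m}. borel)"
    and hom: "\<And>R g c. 0 < c \<Longrightarrow> h (transpose_apply m R (\<lambda>k. (g \<bullet> b k) / c)) = h (transpose_apply m R (\<lambda>k. g \<bullet> b k))"
    and b: "orthonormal_system m b" and j: "j < m"
  shows "(\<integral>\<^sup>+Q. h (sqmat_col m Q j) \<partial>H)
    = (\<integral>\<^sup>+R. (\<integral>\<^sup>+g. h (transpose_apply m R (\<lambda>k. g \<bullet> b k)) \<partial>std_gaussian) \<partial>H)"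
proof -
  interpret G: prob_space "std_gaussian :: 'a measure" by (rule prob_space_std_gaussian)
  interpret P: pair_prob_space H "std_gaussian :: 'a measure" ..
  have "b j \<noteq> 0" using orthonormal_systemD[OF b j j] by auto
  have "(\<integral>\<^sup>+Q. h (sqmat_col m Q j) \<partial>H) = (\<integral>\<^sup>+g. (\<integral>\<^sup>+Q. h (sqmat_col m Q j) \<partial>H) \<partial>(std_gaussian :: 'a measure))"
    by (simp add: G.emeasure_space_1[simplified])
  also have "\<dots> = (\<integral>\<^sup>+g. (\<integral>\<^sup>+R. h (transpose_apply m R (\<lambda>k. g \<bullet> b k)) \<partial>H) \<partial>std_gaussian)"
  proof (rule nn_integral_cong_AE)
    show "AE g in std_gaussian. (\<integral>\<^sup>+Q. h (sqmat_col m Q j) \<partial>H) = (\<integral>\<^sup>+R. h (transpose_apply m R (\<lambda>k. g \<bullet> b k)) \<partial>H)"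
      using AE_std_gaussian_inner_nonzero[OF \<open>b j \<noteq> 0\<close>]
    proof eventually_elim
      fix g :: 'a assume g: "g \<bullet> b j \<noteq> 0"
      define c where "c = sqrt (\<Sum>k<m. (g \<bullet> b k)\<^sup>2)"
      have "0 < (g \<bullet> b j)\<^sup>2" using g by simp
      also have "\<dots> \<le> (\<Sum>k<m. (g \<bullet> b k)\<^sup>2)" using j by (intro member_le_sum) auto
      finally have c: "0 < c" "c\<^sup>2 = (\<Sum>k<m. (g \<bullet> b k)\<^sup>2)" by (simp_all add: c_def)
      have "(\<Sum>k<m. ((g \<bullet> b k) / c)\<^sup>2) = 1"
        using c(1) by (simp add: power_divide c(2)[symmetric] flip: sum_divide_distrib)
      from nn_integral_transpose_apply[OF h this j]
      show "(\<integral>\<^sup>+Q. h (sqmat_col m Q j) \<partial>H) = (\<integral>\<^sup>+R. h (transpose_apply m R (\<lambda>k. g \<bullet> b k)) \<partial>H)"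
        by (simp add: hom[OF c(1)])
    qed
  qed
  also have "\<dots> = (\<integral>\<^sup>+R. (\<integral>\<^sup>+g. h (transpose_apply m R (\<lambda>k. g \<bullet> b k)) \<partial>std_gaussian) \<partial>H)"
  proof (rule P.Fubini')
    have "(\<lambda>x. h (transpose_apply m (fst x) (\<lambda>k. snd x \<bullet> b k))) \<in> borel_measurable (H \<Otimes>\<^sub>M std_gaussian)"
      unfolding transpose_apply_def
      by (intro measurable_compose[OF measurable_restrict h]) (auto intro!: borel_measurable_sum borel_measurable_times borel_measurable_inner
         measurable_compose[OF measurable_fst] measurable_compose[OF measurable_snd] entry_measurable)
    then show "(\<lambda>(R, g). h (transpose_apply m R (\<lambda>k. g \<bullet> b k))) \<in> borel_measurable (H \<Otimes>\<^sub>M std_gaussian)"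
      by (simp add: case_prod_beta')
  qed
  finally show ?thesis .
qed

text \<open>For each fixed \<open>R\<close>, rotating the Gaussian vector amounts to testing it
  against another orthonormal system, so the Gaussian tail bound holds uniformly in \<open>R\<close>
  and is then averaged over \<open>H\<close>.\<close>

lemma random_vector_form_tail:
  fixes b e :: "nat \<Rightarrow> 'a::euclidean_space"
  assumes b: "orthonormal_basis_of F m b" and e: "orthonormal_basis_of F m e" and j: "j < m"
    and "0 < s" "0 < t" and lam: "(\<Sum>i<m. lam i) = 0" "(\<Sum>i<m. (lam i)\<^sup>2) \<le> s\<^sup>2"
  shows "(\<integral>\<^sup>+Q. indicator {u. t * s / sqrt m < \<bar>\<Sum>i<m. lam i * (u \<bullet> e i)\<^sup>2\<bar>} (\<Sum>i<m. Q (i, j) *\<^sub>R b i) \<partial>H)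
    \<le> ennreal (3 * exp (- (t * sqrt m / 8)) + exp (- (m / 12)))" (is "?l \<le> ?r")
proof -
  \<comment> \<open>The homogeneous form of the event: on unit vectors of \<open>F\<close> the extra
    factor is 1 by Parseval's identity, and the event becomes invariant under positive
    scaling.\<close>
  define bad where "bad = {u. t * s / sqrt m * (\<Sum>i<m. (u \<bullet> e i)\<^sup>2) < \<bar>\<Sum>i<m. lam i * (u \<bullet> e i)\<^sup>2\<bar>}"
  define h :: "(nat \<Rightarrow> real) \<Rightarrow> ennreal" where "h = (\<lambda>c. indicator bad (\<Sum>i<m. c i *\<^sub>R b i))"
  have bs: "orthonormal_system m b" and es: "orthonormal_system m e"
    using b e by (auto simp: orthonormal_basis_of_def)
  have [measurable]: "bad \<in> sets borel" unfolding bad_def by measurable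
  have h[measurable]: "h \<in> borel_measurable (\<Pi>\<^sub>M i \<in> {..<m}. borel)"
    unfolding h_def by measurable
  have scale: "c *\<^sub>R u \<in> bad \<longleftrightarrow> u \<in> bad" if "0 < c" for c u
  proof -
    let ?X = "\<Sum>i<m. lam i * (u \<bullet> e i)\<^sup>2" and ?Y = "t * s / sqrt m * (\<Sum>i<m. (u \<bullet> e i)\<^sup>2)"
    have "(\<Sum>i<m. lam i * (c *\<^sub>R u \<bullet> e i)\<^sup>2) = c\<^sup>2 * ?X"
      "t * s / sqrt m * (\<Sum>i<m. (c *\<^sub>R u \<bullet> e i)\<^sup>2) = c\<^sup>2 * ?Y"
      by (simp_all add: sum_distrib_left power_mult_distrib mult_ac)
    then have "c *\<^sub>R u \<in> bad \<longleftrightarrow> c\<^sup>2 * ?Y < c\<^sup>2 * \<bar>?X\<bar>"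
      by (simp only: bad_def mem_Collect_eq abs_mult abs_power2)
    also have "\<dots> \<longleftrightarrow> u \<in> bad"
      using that by (simp only: bad_def mem_Collect_eq mult_less_cancel_left_pos zero_less_power)
    finally show ?thesis .
  qed
  have hom: "h (transpose_apply m R (\<lambda>k. (g \<bullet> b k) / c)) = h (transpose_apply m R (\<lambda>k. g \<bullet> b k))"
    if "0 < c" for R and g :: 'a and c
  proof -
    have "(\<Sum>i<m. transpose_apply m R (\<lambda>k. (g \<bullet> b k) / c) i *\<^sub>R b i)
      = (1 / c) *\<^sub>R (\<Sum>i<m. transpose_apply m R (\<lambda>k. g \<bullet> b k) i *\<^sub>R b i)"
      by (simp add: transpose_apply_def scaleR_sum_right sum_divide_distrib)
    then show ?thesis using scale[of "1 / c"] that by (simp add: h_def indicator_def)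
  qed
  have "?l = (\<integral>\<^sup>+Q. h (sqmat_col m Q j) \<partial>H)"
  proof (rule nn_integral_cong)
    fix Q assume "Q \<in> space H"
    then have Q: "Q \<in> orthogonal_group m" by (simp add: space_H)
    define u where "u = (\<Sum>i<m. Q (i, j) *\<^sub>R b i)"
    have "u \<in> F" unfolding u_def by (rule orthonormal_basis_of_sum_mem[OF b])
    from orthonormal_basis_of_inner[OF e this] have "(\<Sum>i<m. (u \<bullet> e i)\<^sup>2) = u \<bullet> u"
      by (simp add: power2_eq_square)
    also have "\<dots> = 1"
      using orthonormal_systemD[OF orthogonal_group_combination[OF bs Q] j j] by (simp add: u_def)
    finally have "u \<in> {u. t * s / sqrt m < \<bar>\<Sum>i<m. lam i * (u \<bullet> e i)\<^sup>2\<bar>} \<longleftrightarrow> u \<in> bad"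
      by (simp add: bad_def)
    then show "indicator {u. t * s / sqrt m < \<bar>\<Sum>i<m. lam i * (u \<bullet> e i)\<^sup>2\<bar>} (\<Sum>i<m. Q (i, j) *\<^sub>R b i) = h (sqmat_col m Q j)"
      by (simp add: h_def u_def sqmat_col_def indicator_def)
  qed
  also have "\<dots> = (\<integral>\<^sup>+R. (\<integral>\<^sup>+g. h (transpose_apply m R (\<lambda>k. g \<bullet> b k)) \<partial>std_gaussian) \<partial>H)"
    by (rule nn_integral_sqmat_col_gaussian[OF h hom bs j])
  also have "\<dots> \<le> (\<integral>\<^sup>+R. ?r \<partial>H)"
  proof (rule nn_integral_mono)
    fix R assume "R \<in> space H"
    then have R: "R \<in> orthogonal_group m" by (simp add: space_H)
    \<comment> \<open>The rotation is moved onto \<open>e\<close>: \<open>c l\<close> is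
      \<open>R\<close> applied to the coordinates of \<open>e l\<close> along \<open>b\<close>, and
      \<open>e' l\<close> is the vector with these new coordinates.\<close>
    define c where "c = (\<lambda>l k. \<Sum>i<m. R (k, i) * (b i \<bullet> e l))"
    define e' where "e' = (\<lambda>l. \<Sum>k<m. c l k *\<^sub>R b k)"
    have ue: "(\<Sum>i<m. transpose_apply m R (\<lambda>k. g \<bullet> b k) i *\<^sub>R b i) \<bullet> e l = g \<bullet> e' l" for g l
    proof -
      have "(\<Sum>i<m. transpose_apply m R (\<lambda>k. g \<bullet> b k) i *\<^sub>R b i) \<bullet> e l
        = (\<Sum>i<m. \<Sum>k<m. R (k, i) * (g \<bullet> b k) * (b i \<bullet> e l))"
        by (simp add: transpose_apply_def inner_sum_left sum_distrib_right)
      also have "\<dots> = (\<Sum>k<m. \<Sum>i<m. R (k, i) * (g \<bullet> b k) * (b i \<bullet> e l))"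
        by (rule sum.swap)
      also have "\<dots> = g \<bullet> e' l"
        by (simp add: e'_def c_def inner_sum_right sum_distrib_left mult_ac)
      finally show ?thesis .
    qed
    have "orthonormal_system m e'"
    proof -
      have "e' l \<bullet> e' l' = (if l = l' then 1 else 0)" if l: "l < m" "l' < m" for l l'
      proof -
        have "e' l \<bullet> b k = c l k" if "k < m" for l k
          using that by (simp add: e'_def inner_sum_left orthonormal_systemD[OF bs] if_distrib cong: if_cong)
        then have "e' l \<bullet> e' l' = (\<Sum>k<m. c l k * c l' k)"
          by (subst e'_def) (simp add: e'_def[symmetric] inner_sum_right mult.commute)
        also have "\<dots> = (\<Sum>k<m. \<Sum>i<m. \<Sum>i'<m. (b i \<bullet> e l) * (b i' \<bullet> e l') * (R (k, i) * R (k, i')))"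
          unfolding c_def sum_product by (simp add: mult_ac)
        also have "\<dots> = (\<Sum>i<m. \<Sum>k<m. \<Sum>i'<m. (b i \<bullet> e l) * (b i' \<bullet> e l') * (R (k, i) * R (k, i')))"
          by (rule sum.swap)
        also have "\<dots> = (\<Sum>i<m. \<Sum>i'<m. \<Sum>k<m. (b i \<bullet> e l) * (b i' \<bullet> e l') * (R (k, i) * R (k, i')))"
          by (intro sum.cong refl sum.swap)
        also have "\<dots> = (\<Sum>i<m. \<Sum>i'<m. (b i \<bullet> e l) * (b i' \<bullet> e l') * (if i = i' then 1 else 0))"
          by (intro sum.cong refl) (simp add: orthogonal_groupD[OF R] flip: sum_distrib_left)
        also have "\<dots> = (\<Sum>i<m. (e l \<bullet> b i) * (e l' \<bullet> b i))"
          by (simp add: if_distrib[of "\<lambda>x. _ * x"] inner_commute cong: if_cong)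
        also have "\<dots> = e l \<bullet> e l'"
          by (rule orthonormal_basis_of_inner[OF b orthonormal_basis_of_mem[OF e l(2)], symmetric])
        finally show ?thesis using orthonormal_systemD[OF es l] by simp
      qed
      then show ?thesis by (simp add: orthonormal_system_def)
    qed
    from std_gaussian_traceless_form_tail[OF this _ \<open>0 < s\<close> \<open>0 < t\<close> lam] j
    show "(\<integral>\<^sup>+g. h (transpose_apply m R (\<lambda>k. g \<bullet> b k)) \<partial>std_gaussian) \<le> ?r"
      by (simp add: h_def bad_def ue indicator_def)
  qed
  also have "\<dots> = ?r" by (simp add: emeasure_space_1)
  finally show ?thesis .
qed

end

subsection \<open>Spectrum of vertex-transitive graphs\<close>

locale vertex_transitive_graph =
  fixes G :: "'v::finite pair_pre_digraph"
  assumes graph: "pair_graph G" and vertices: "pverts G = UNIV"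
    and conn: "Digraph_Component.connected (with_proj G)"
    and transitive: "vertex_transitive G"
begin

abbreviation "A \<equiv> adjacency_matrix G"

lemma arcs_sym: "(x, y) \<in> parcs G \<longleftrightarrow> (y, x) \<in> parcs G"
proof -
  interpret pair_graph G by (rule graph)
  show ?thesis using arcs_symmetric by blast
qed

lemma adjacency_apply: "(A *v u) $ x = (\<Sum>y | (x, y) \<in> parcs G. u $ y)"
  by (simp add: matrix_vector_mult_def adjacency_matrix_def if_distrib[of "\<lambda>a. a * _"] sum.If_cases cong: if_cong)

lemma adjacency_self_adjoint: "u \<bullet> (A *v w) = (A *v u) \<bullet> w"
proof -
  have "transpose A = A" using arcs_sym by (auto simp: transpose_def adjacency_matrix_def vec_eq_iff)
  then show ?thesis by (metis dot_lmul_matrix vector_transpose_matrix)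
qed

lemma subspace_eigenspace: "subspace (eigenspace (B :: real ^ 'v ^ 'v) l)"
  by (auto simp: subspace_def eigenspace_def matrix_vector_right_distrib matrix_vector_mult_scaleR scaleR_add_right)

text \<open>Eigenvectors of different eigenvalues are orthogonal by self-adjointness, so one choice
  per eigenvalue gives an independent, hence finite, set.\<close>

lemma finite_eigenvalues: "finite (eigenvalues A)"
proof -
  define w where "w = (\<lambda>l. SOME u. u \<noteq> 0 \<and> A *v u = l *\<^sub>R u)"
  have w: "w l \<noteq> 0 \<and> A *v w l = l *\<^sub>R w l" if "l \<in> eigenvalues A" for l
    using someI_ex[of "\<lambda>u. u \<noteq> 0 \<and> A *v u = l *\<^sub>R u"] that
    unfolding w_def eigenvalues_def by simp
  have orth: "w l \<bullet> w k = 0" if "l \<in> eigenvalues A" "k \<in> eigenvalues A" "l \<noteq> k" for l k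
    using adjacency_self_adjoint[of "w l" "w k"] w[OF that(1)] w[OF that(2)] that(3) by simp
  have "pairwise orthogonal (w ` eigenvalues A)" "0 \<notin> w ` eigenvalues A"
    using orth w by (auto simp: pairwise_def orthogonal_def)
  then have "finite (w ` eigenvalues A)"
    by (intro finiteI_independent pairwise_orthogonal_independent)
  moreover have "inj_on w (eigenvalues A)"
    using orth w by (intro inj_onI) (metis inner_eq_zero_iff)
  ultimately show ?thesis by (rule finite_imageD)
qed

text \<open>Reduces the isomorphism record, with its separate arc, tail and head maps, to a vertex
  permutation preserving adjacency.\<close>

lemma automorphism_exists:
  "\<exists>\<sigma>. bij \<sigma> \<and> (\<forall>x y. (\<sigma> x, \<sigma> y) \<in> parcs G \<longleftrightarrow> (x, y) \<in> parcs G) \<and> \<sigma> v = w"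
proof -
  obtain h where h: "graph_automorphism G h" and vw: "iso_verts h v = w"
    using transitive vertices unfolding vertex_transitive_def by blast
  have iso: "pre_digraph.digraph_isomorphism (with_proj G) h" and app: "app_iso h (with_proj G) = with_proj G"
    using h by (auto simp: graph_automorphism_def)
  \<comment> \<open>Equality of the image with \<open>G\<close> forces the tail and head maps to be
    the projections, so on arcs the arc map is determined by the vertex map.\<close>
  have ht: "iso_tail h = fst" "iso_head h = snd" "iso_arcs h ` parcs G = parcs G" "range (iso_verts h) = UNIV"
    using tail_app_iso[of h "with_proj G"] head_app_iso[of h "with_proj G"] arcs_app_iso[of h "with_proj G"]
      verts_app_iso[of h "with_proj G"] vertices by (auto simp only: app with_proj_simps)
  have "inj (iso_verts h)"
    using iso vertices by (simp add: pre_digraph.digraph_isomorphism_def)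
  then have bij: "bij (iso_verts h)" using ht(4) by (simp add: bij_def)
  have arc: "iso_arcs h (x, y) = (iso_verts h x, iso_verts h y)" if "(x, y) \<in> parcs G" for x y
    using iso that ht(1,2) by (fastforce simp: pre_digraph.digraph_isomorphism_def prod_eq_iff)
  have "(iso_verts h x, iso_verts h y) \<in> parcs G \<longleftrightarrow> (x, y) \<in> parcs G" for x y
  proof
    assume "(iso_verts h x, iso_verts h y) \<in> parcs G"
    then obtain x' y' where "(x', y') \<in> parcs G" "iso_arcs h (x', y') = (iso_verts h x, iso_verts h y)"
      using ht(3) by (metis imageE surj_pair)
    then show "(x, y) \<in> parcs G" using arc \<open>inj (iso_verts h)\<close> by (auto simp: inj_eq)
  next
    assume "(x, y) \<in> parcs G" then show "(iso_verts h x, iso_verts h y) \<in> parcs G" using arc ht(3) by force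
  qed
  then show ?thesis using bij vw by blast
qed

lemma bij_betw_neighbours:
  assumes "bij \<sigma>" and "\<And>x y. (\<sigma> x, \<sigma> y) \<in> parcs G \<longleftrightarrow> (x, y) \<in> parcs G"
  shows "bij_betw \<sigma> {y. (x, y) \<in> parcs G} {y. (\<sigma> x, y) \<in> parcs G}"
proof (rule bij_betw_imageI)
  show "inj_on \<sigma> {y. (x, y) \<in> parcs G}" using bij_is_inj[OF assms(1)] by (rule inj_on_subset) simp
  have "y \<in> \<sigma> ` {y. (x, y) \<in> parcs G}" if "(\<sigma> x, y) \<in> parcs G" for y
  proof -
    obtain z where "y = \<sigma> z" using surjD[OF bij_is_surj[OF assms(1)]] by blast
    then show ?thesis using that assms(2)[of x z] by simp
  qed
  then show "\<sigma> ` {y. (x, y) \<in> parcs G} = {y. (\<sigma> x, y) \<in> parcs G}" using assms(2) by auto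
qed

text \<open>The sum is the squared length of the projection of the axis vector at \<open>x\<close>,
  hence independent of the basis. Moving the basis by an automorphism carries \<open>x\<close> to
  any other vertex, so the sum is constant in \<open>x\<close>; its total over all vertices is the
  trace \<open>m\<close> of the projection.\<close>

lemma eigenbasis_diagonal:
  assumes e: "orthonormal_basis_of (eigenspace A l) m e"
  shows "(\<Sum>i<m. (e i $ x)\<^sup>2) = m / CARD('v)"
proof -
  have dim: "dim (eigenspace A l) = m"
  proof -
    have "dim (span (e ` {..<m})) = m"
      using e orthonormal_system_independent[of m e] orthonormal_system_inj_on[of m e]
      unfolding orthonormal_basis_of_def
      by (subst dim_span_eq_card_independent) (auto simp: card_image)
    moreover have "span (e ` {..<m}) = eigenspace A l" using e by (simp add: orthonormal_basis_of_def)
    ultimately show ?thesis by metis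
  qed
  have const: "(\<Sum>i<m. (e i $ x)\<^sup>2) = (\<Sum>i<m. (e i $ y)\<^sup>2)" for x y
  proof -
    obtain \<sigma> where \<sigma>: "bij \<sigma>" "\<And>x y. (\<sigma> x, \<sigma> y) \<in> parcs G \<longleftrightarrow> (x, y) \<in> parcs G" "\<sigma> x = y"
      using automorphism_exists[of x y] by blast
    define e' where "e' = (\<lambda>i. \<chi> z. e i $ \<sigma> z)"
    have "orthonormal_basis_of (eigenspace A l) m e'"
    proof (rule orthonormal_basis_ofI[OF subspace_eigenspace dim])
      have "e' i \<bullet> e' j = e i \<bullet> e j" for i j
        using sum.reindex_bij_betw[OF \<sigma>(1), of "\<lambda>z. e i $ z * e j $ z"] by (simp add: e'_def inner_vec_def)
      then show "orthonormal_system m e'"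
        using e by (simp add: orthonormal_basis_of_def orthonormal_system_def)
      show "e' i \<in> eigenspace A l" if "i < m" for i
      proof -
        have "A *v e i = l *\<^sub>R e i" using orthonormal_basis_of_mem[OF e that] by (simp add: eigenspace_def)
        \<comment> \<open>An automorphism maps the neighbours of \<open>z\<close> onto those of
          \<open>\<sigma> z\<close>, so composition with it commutes with \<open>A\<close>.\<close>
        moreover have "(A *v e' i) $ z = (A *v e i) $ \<sigma> z" for z
        proof -
          from sum.reindex_bij_betw[OF bij_betw_neighbours[OF \<sigma>(1,2)], of "\<lambda>y. e i $ y" z]
          show ?thesis by (simp add: adjacency_apply e'_def)
        qed
        ultimately show ?thesis by (simp add: eigenspace_def vec_eq_iff e'_def)
      qed
    qed
    from orthonormal_basis_of_sum_squares_eq[OF e this, of "axis x 1"]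
    show ?thesis by (simp add: inner_axis' e'_def \<sigma>(3))
  qed
  have "CARD('v) * (\<Sum>i<m. (e i $ x)\<^sup>2) = (\<Sum>y\<in>(UNIV :: 'v set). \<Sum>i<m. (e i $ x)\<^sup>2)" by simp
  also have "\<dots> = (\<Sum>y\<in>UNIV. \<Sum>i<m. (e i $ y)\<^sup>2)" by (intro sum.cong refl const)
  also have "\<dots> = (\<Sum>i<m. e i \<bullet> e i)" by (subst sum.swap) (simp add: inner_vec_def power2_eq_square)
  also have "\<dots> = m" using e by (simp add: orthonormal_basis_of_def orthonormal_system_def)
  finally show ?thesis by (simp add: field_simps)
qed

text \<open>Transitivity makes the degree constant, so the \<open>THE\<close> in
  \<open>common_degree\<close> is well defined.\<close>

lemma card_neighbours: "card {y. (x, y) \<in> parcs G} = common_degree G"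
proof -
  have card: "out_degree (with_proj G) x = card {y. (x, y) \<in> parcs G}" for x
  proof -
    have "out_arcs (with_proj G) x = Pair x ` {y. (x, y) \<in> parcs G}" by (auto simp: out_arcs_def)
    then show ?thesis by (simp add: out_degree_def card_image inj_on_def)
  qed
  have const: "card {y. (v, y) \<in> parcs G} = card {y. (w, y) \<in> parcs G}" for v w
  proof -
    obtain \<sigma> where \<sigma>: "bij \<sigma>" "\<And>x y. (\<sigma> x, \<sigma> y) \<in> parcs G \<longleftrightarrow> (x, y) \<in> parcs G" "\<sigma> v = w"
      using automorphism_exists[of v w] by blast
    show ?thesis using bij_betw_same_card[OF bij_betw_neighbours[OF \<sigma>(1,2), of v]] by (simp add: \<sigma>(3))
  qed
  show ?thesis unfolding common_degree_def card
    by (rule the_equality[symmetric]) (use const vertices in auto)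
qed

text \<open>The Dirichlet form of \<open>u\<close> is twice the difference of
  \<open>u \<bullet> (d u)\<close> and \<open>u \<bullet> (A u)\<close>, so it vanishes;
  \<open>u\<close> is then constant along arcs, and everywhere by connectedness.\<close>

lemma trivial_eigenvector_constant:
  assumes u: "u \<in> eigenspace A (real (common_degree G))"
  shows "u $ x = u $ y"
proof -
  let ?a = "\<lambda>x y. A $ x $ y" and ?d = "real (common_degree G)"
  have row: "(\<Sum>y\<in>UNIV. ?a x y) = ?d" for x
    using adjacency_apply[of "\<chi> _. 1" x] by (simp add: card_neighbours matrix_vector_mult_def)
  have a_sym: "?a x y = ?a y x" for x y using arcs_sym by (simp add: adjacency_matrix_def)
  have eig: "(\<Sum>y\<in>UNIV. ?a x y * u $ y) = ?d * u $ x" for x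
    using u by (simp add: eigenspace_def vec_eq_iff matrix_vector_mult_def)
  have s1: "(\<Sum>x\<in>UNIV. \<Sum>y\<in>UNIV. ?a x y * (u $ x)\<^sup>2) = (\<Sum>x\<in>UNIV. ?d * (u $ x)\<^sup>2)"
    by (simp add: row flip: sum_distrib_right)
  have s2: "(\<Sum>x\<in>UNIV. \<Sum>y\<in>UNIV. ?a x y * (u $ y)\<^sup>2) = (\<Sum>x\<in>UNIV. ?d * (u $ x)\<^sup>2)"
    by (subst sum.swap, subst a_sym) (simp add: row flip: sum_distrib_right)
  have s3: "(\<Sum>x\<in>UNIV. \<Sum>y\<in>UNIV. u $ x * (?a x y * u $ y)) = (\<Sum>x\<in>UNIV. ?d * (u $ x)\<^sup>2)"
  proof (rule sum.cong[OF refl])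
    fix x show "(\<Sum>y\<in>UNIV. u $ x * (?a x y * u $ y)) = ?d * (u $ x)\<^sup>2"
      unfolding sum_distrib_left[symmetric] eig by (simp add: power2_eq_square)
  qed
  have "(\<Sum>x\<in>UNIV. \<Sum>y\<in>UNIV. ?a x y * (u $ x - u $ y)\<^sup>2)
    = (\<Sum>x\<in>UNIV. \<Sum>y\<in>UNIV. ?a x y * (u $ x)\<^sup>2 + ?a x y * (u $ y)\<^sup>2 - 2 * (u $ x * (?a x y * u $ y)))"
    by (intro sum.cong refl) (simp add: power2_eq_square algebra_simps)
  also have "\<dots> = 0"
    by (simp add: sum.distrib sum_subtractf s1 s2 s3 sum_distrib_left[of "2 :: real", symmetric])
  finally have zero: "(\<Sum>x\<in>UNIV. \<Sum>y\<in>UNIV. ?a x y * (u $ x - u $ y)\<^sup>2) = 0" .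
  have nonneg: "0 \<le> ?a x y * (u $ x - u $ y)\<^sup>2" for x y by (simp add: adjacency_matrix_def)
  have "(\<Sum>y\<in>UNIV. ?a x y * (u $ x - u $ y)\<^sup>2) = 0" for x
    using zero by (subst (asm) sum_nonneg_eq_0_iff) (auto intro: sum_nonneg nonneg)
  then have "?a x y * (u $ x - u $ y)\<^sup>2 = 0" for x y
    using nonneg by (simp add: sum_nonneg_eq_0_iff)
  then have arc: "u $ x = u $ y" if "(x, y) \<in> parcs G" for x y
    using that by (force simp: adjacency_matrix_def)
  \<comment> \<open>Connectedness refers to the symmetric closure of the digraph, which adds no arcs
    here.\<close>
  have "parcs (mk_symmetric (with_proj G)) \<subseteq> parcs G"
    using arcs_sym by (auto simp: parcs_mk_symmetric)
  moreover have "(x, y) \<in> (arcs_ends (with_proj (mk_symmetric (with_proj G))))\<^sup>*"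
    using conn vertices
    by (auto simp: connected_def strongly_connected_def reachable_def intro: rtrancl_on_rtranclI)
  ultimately have "(x, y) \<in> (parcs G)\<^sup>*" using rtrancl_mono by (auto simp only: with_proj_simps)
  then show ?thesis by (induction rule: rtrancl_induct) (auto dest: arc)
qed

end

subsection \<open>Random eigenbases\<close>

lemma orthonormal_bases_iff:
  "e \<in> orthonormal_bases F \<longleftrightarrow> e \<in> {..<dim F} \<rightarrow>\<^sub>E UNIV \<and> orthonormal_basis_of F (dim F) e"
  by (auto simp: orthonormal_bases_def orthonormal_basis_of_def orthonormal_system_def)

lemma orthonormal_basis_of_combination:
  assumes F: "subspace F" "dim F = m" and b: "orthonormal_basis_of F m b" and Q: "Q \<in> orthogonal_group m"
  shows "orthonormal_basis_of F m (\<lambda>j. \<Sum>i<m. Q (i, j) *\<^sub>R b i)"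
proof (rule orthonormal_basis_ofI[OF F])
  show "orthonormal_system m (\<lambda>j. \<Sum>i<m. Q (i, j) *\<^sub>R b i)"
    using b Q by (intro orthogonal_group_combination) (auto simp: orthonormal_basis_of_def)
  show "(\<Sum>i<m. Q (i, j) *\<^sub>R b i) \<in> F" for j by (rule orthonormal_basis_of_sum_mem[OF b])
qed

lemma onb_of_matrix_orthonormal_bases:
  assumes "subspace F" "b \<in> orthonormal_bases F" "Q \<in> orthogonal_group (dim F)"
  shows "onb_of_matrix F b Q \<in> orthonormal_bases F"
proof -
  define c where "c = (\<lambda>j. \<Sum>i<dim F. Q (i, j) *\<^sub>R b i)"
  have "orthonormal_basis_of F (dim F) c"
    unfolding c_def using assms by (intro orthonormal_basis_of_combination) (auto simp: orthonormal_bases_iff)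
  moreover have "onb_of_matrix F b Q = restrict c {..<dim F}" by (simp add: onb_of_matrix_def c_def)
  ultimately show ?thesis
    by (simp add: orthonormal_bases_iff orthonormal_basis_of_def orthonormal_system_def)
qed

lemma (in haar_group) measurable_onb_of_matrix:
  assumes "subspace F" "dim F = m" "b \<in> orthonormal_bases F"
  shows "onb_of_matrix F b \<in> measurable H (onb_space F)"
  unfolding onb_space_def
proof (rule measurable_restrict_space2)
  show "onb_of_matrix F b \<in> space H \<rightarrow> orthonormal_bases F"
    using assms by (auto simp: space_H intro: onb_of_matrix_orthonormal_bases)
  show "onb_of_matrix F b \<in> measurable H (\<Pi>\<^sub>M j \<in> {..<dim F}. borel)"
    unfolding onb_of_matrix_def using assms(2)
    by (intro measurable_restrict) (auto intro!: borel_measurable_sum borel_measurable_scaleR)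
qed

context vertex_transitive_graph begin

lemma random_eigenvector_tail:
  fixes f :: "real ^ 'v"
  assumes H: "haar_probability m H" and b: "orthonormal_basis_of (eigenspace A l) m b"
    and dim: "dim (eigenspace A l) = m" and j: "j < m" and t: "0 < t"
  shows "(\<integral>\<^sup>+Q. indicator {u. t * (norm f / sqrt CARD('v))
        < \<bar>(\<Sum>x\<in>UNIV. f $ x * (u $ x)\<^sup>2) - 1 / CARD('v) * (\<Sum>x\<in>UNIV. f $ x)\<bar>}
      (\<Sum>i<m. Q (i, j) *\<^sub>R b i) \<partial>H)
    \<le> ennreal (3 * exp (- (t * sqrt m / 8)) + exp (- (m / 12)))" (is "?l \<le> ?r")
\<comment> \<open>For \<open>f = 0\<close> the strict inequality never holds; otherwise
  \<open>s\<close> below is positive, as the tail bound requires.\<close>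
proof (cases "f = 0")
  case False
  interpret haar_group m H by unfold_locales (rule H)
  let ?F = "eigenspace A l" and ?n = "real CARD('v)"
  define T where "T = (\<lambda>u::real^'v. \<chi> x. f $ x * u $ x)"
  have T: "linear T" by (auto intro!: linearI simp: T_def vec_eq_iff algebra_simps)
  have inner_T: "u \<bullet> T w = (\<Sum>x\<in>UNIV. f $ x * (u $ x * w $ x))" for u w
    by (simp add: T_def inner_vec_def mult_ac)
  have sym: "u \<bullet> T w = w \<bullet> T u" for u w by (simp add: inner_T mult_ac)
  obtain e where e: "orthonormal_basis_of ?F m e"
    and diag: "\<And>i k. i < m \<Longrightarrow> k < m \<Longrightarrow> i \<noteq> k \<Longrightarrow> e i \<bullet> T (e k) = 0"
    using orthonormal_diagonalization[OF T sym subspace_eigenspace dim] by blast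
  have ee: "e i \<bullet> e i = 1" if "i < m" for i
    using e that by (simp add: orthonormal_basis_of_def orthonormal_system_def)
  define \<mu> where "\<mu> = (\<lambda>i. e i \<bullet> T (e i))"
  define avg where "avg = 1 / ?n * (\<Sum>x\<in>UNIV. f $ x)"
  \<comment> \<open>The scale at which \<open>s\<^sup>2\<close> bounds the sum of the squared
    eigenvalues and \<open>t * s / sqrt m\<close> is the threshold of the statement.\<close>
  define s where "s = sqrt (m / ?n) * norm f"
  have s: "0 < s" "s\<^sup>2 = m / ?n * (norm f)\<^sup>2" using False j by (simp_all add: s_def power_mult_distrib)
  have form: "(\<Sum>x\<in>UNIV. f $ x * (u $ x)\<^sup>2) = (\<Sum>i<m. \<mu> i * (u \<bullet> e i)\<^sup>2)" if u: "u \<in> ?F" for u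
  proof -
    have "T u \<bullet> e i = \<mu> i * (u \<bullet> e i)" if i: "i < m" for i
    proof -
      have "T u = (\<Sum>k<m. (u \<bullet> e k) *\<^sub>R T (e k))"
        by (subst orthonormal_basis_of_expand[OF e u]) (simp add: linear_sum[OF T] linear_scale[OF T])
      then have "T u \<bullet> e i = (\<Sum>k<m. (u \<bullet> e k) * (e i \<bullet> T (e k)))"
        by (simp add: inner_commute[of _ "e i"] inner_sum_right)
      also have "\<dots> = (\<Sum>k<m. if k = i then \<mu> i * (u \<bullet> e i) else 0)"
        using i by (intro sum.cong) (auto simp: diag \<mu>_def)
      finally show ?thesis using i by simp
    qed
    then have "T u \<bullet> u = (\<Sum>i<m. \<mu> i * (u \<bullet> e i)\<^sup>2)"
      using orthonormal_basis_of_inner[OF e u, of "T u"] by (simp add: power2_eq_square mult.assoc)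
    then show ?thesis by (simp add: inner_commute[of "T u" u] inner_T power2_eq_square)
  qed
  have tr: "(\<Sum>i<m. \<mu> i) = m * avg"
  proof -
    have "(\<Sum>i<m. \<mu> i) = (\<Sum>x\<in>UNIV. f $ x * (\<Sum>i<m. (e i $ x)\<^sup>2))"
      unfolding \<mu>_def inner_T sum_distrib_left by (subst sum.swap) (simp add: power2_eq_square)
    also have "\<dots> = (\<Sum>x\<in>UNIV. f $ x) * (m / ?n)"
      unfolding eigenbasis_diagonal[OF e] by (rule sum_distrib_right[symmetric])
    finally show ?thesis by (simp add: avg_def)
  qed
  have hs: "(\<Sum>i<m. (\<mu> i)\<^sup>2) \<le> s\<^sup>2"
  proof -
    \<comment> \<open>Cauchy-Schwarz for the pointwise product of \<open>f\<close> and
      \<open>e i\<close> against the unit vector \<open>e i\<close>.\<close>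
    have "(\<mu> i)\<^sup>2 \<le> (\<Sum>x\<in>UNIV. (f $ x)\<^sup>2 * (e i $ x)\<^sup>2)" if "i < m" for i
    proof -
      have "(\<mu> i)\<^sup>2 = (\<Sum>x\<in>UNIV. (f $ x * e i $ x) * e i $ x)\<^sup>2" by (simp add: \<mu>_def inner_T mult.assoc)
      also have "\<dots> \<le> (\<Sum>x\<in>UNIV. (f $ x * e i $ x)\<^sup>2) * (\<Sum>x\<in>UNIV. (e i $ x)\<^sup>2)"
        by (rule Cauchy_Schwarz_ineq_sum)
      also have "(\<Sum>x\<in>UNIV. (e i $ x)\<^sup>2) = 1" using ee[OF that] by (simp add: inner_vec_def power2_eq_square)
      finally show ?thesis by (simp add: power_mult_distrib)
    qed
    then have "(\<Sum>i<m. (\<mu> i)\<^sup>2) \<le> (\<Sum>i<m. \<Sum>x\<in>UNIV. (f $ x)\<^sup>2 * (e i $ x)\<^sup>2)" by (intro sum_mono) simp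
    also have "\<dots> = (\<Sum>x\<in>UNIV. (f $ x)\<^sup>2 * (\<Sum>i<m. (e i $ x)\<^sup>2))"
      by (subst sum.swap) (simp add: sum_distrib_left)
    also have "\<dots> = (\<Sum>x\<in>UNIV. (f $ x)\<^sup>2) * (m / ?n)"
      unfolding eigenbasis_diagonal[OF e] by (rule sum_distrib_right[symmetric])
    also have "(\<Sum>x\<in>UNIV. (f $ x)\<^sup>2) = (norm f)\<^sup>2"
      unfolding power2_norm_eq_inner inner_vec_def by (simp add: power2_eq_square)
    finally show ?thesis by (simp add: s(2) mult.commute)
  qed
  define lam where "lam = (\<lambda>i. \<mu> i - avg)"
  have lam: "(\<Sum>i<m. lam i) = 0" by (simp add: lam_def sum_subtractf tr)
  \<comment> \<open>The variance identity: centring at the mean can only lower the sum of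
    squares.\<close>
  have "(\<Sum>i<m. (lam i)\<^sup>2) = (\<Sum>i<m. (\<mu> i)\<^sup>2 + avg\<^sup>2 - 2 * avg * \<mu> i)"
    by (intro sum.cong) (auto simp: lam_def power2_eq_square algebra_simps)
  also have "\<dots> = (\<Sum>i<m. (\<mu> i)\<^sup>2) - m * avg\<^sup>2"
    by (simp add: sum.distrib sum_subtractf tr power2_eq_square flip: sum_distrib_left)
  also have "\<dots> \<le> s\<^sup>2" using hs by (smt (verit) mult_nonneg_nonneg of_nat_0_le_iff zero_le_power2)
  finally have lam2: "(\<Sum>i<m. (lam i)\<^sup>2) \<le> s\<^sup>2" .
  have ts: "t * (norm f / sqrt ?n) = t * s / sqrt m" using j by (simp add: s_def real_sqrt_divide)
  have "?l = (\<integral>\<^sup>+Q. indicator {u. t * s / sqrt m < \<bar>\<Sum>i<m. lam i * (u \<bullet> e i)\<^sup>2\<bar>} (\<Sum>i<m. Q (i, j) *\<^sub>R b i) \<partial>H)"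
  proof (rule nn_integral_cong)
    fix Q assume "Q \<in> space H"
    then have Q: "Q \<in> orthogonal_group m" by (simp add: space_H)
    define u where "u = (\<Sum>i<m. Q (i, j) *\<^sub>R b i)"
    have ob: "orthonormal_basis_of ?F m (\<lambda>j. \<Sum>i<m. Q (i, j) *\<^sub>R b i)"
      by (rule orthonormal_basis_of_combination[OF subspace_eigenspace dim b Q])
    have u: "u \<in> ?F" "u \<bullet> u = 1"
      using orthonormal_basis_of_mem[OF ob j] ob j
      by (auto simp: u_def orthonormal_basis_of_def orthonormal_system_def)
    \<comment> \<open>On unit vectors, centring the eigenvalues therefore shifts the form by exactly
      \<open>avg\<close>.\<close>
    have "(\<Sum>i<m. (u \<bullet> e i)\<^sup>2) = 1"
      using orthonormal_basis_of_inner[OF e u(1), of u] u(2) by (simp add: power2_eq_square)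
    then have "(\<Sum>i<m. lam i * (u \<bullet> e i)\<^sup>2) = (\<Sum>x\<in>UNIV. f $ x * (u $ x)\<^sup>2) - avg"
      by (simp add: form[OF u(1)] lam_def left_diff_distrib sum_subtractf flip: sum_distrib_left)
    then show "indicator {u. t * (norm f / sqrt ?n)
        < \<bar>(\<Sum>x\<in>UNIV. f $ x * (u $ x)\<^sup>2) - 1 / ?n * (\<Sum>x\<in>UNIV. f $ x)\<bar>} (\<Sum>i<m. Q (i, j) *\<^sub>R b i)
      = (indicator {u. t * s / sqrt m < \<bar>\<Sum>i<m. lam i * (u \<bullet> e i)\<^sup>2\<bar>} (\<Sum>i<m. Q (i, j) *\<^sub>R b i) :: ennreal)"
      unfolding u_def[symmetric] avg_def[symmetric] ts by (simp add: indicator_def)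
  qed
  also have "\<dots> \<le> ?r" by (rule random_vector_form_tail[OF b e j s(1) t lam lam2])
  finally show ?thesis .
qed simp

text \<open>A constant unit vector has all squares equal to \<open>1 / CARD('v)\<close>, so the
  weighted sum is the mean.\<close>

lemma trivial_eigenvector_deviation:
  fixes f :: "real ^ 'v"
  assumes u: "u \<in> eigenspace A (real (common_degree G))" "u \<bullet> u = 1"
  shows "(\<Sum>x\<in>UNIV. f $ x * (u $ x)\<^sup>2) - 1 / CARD('v) * (\<Sum>x\<in>UNIV. f $ x) = 0"
proof -
  have "(u $ x)\<^sup>2 = 1 / CARD('v)" for x
  proof -
    have "u \<bullet> u = (\<Sum>y\<in>(UNIV :: 'v set). (u $ x)\<^sup>2)"
      unfolding inner_vec_def
    proof (rule sum.cong[OF refl])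
      fix y show "u $ y \<bullet> u $ y = (u $ x)\<^sup>2"
        using trivial_eigenvector_constant[OF u(1), of y x] by (simp add: power2_eq_square)
    qed
    then show ?thesis using u(2) by (simp add: field_simps)
  qed
  then show ?thesis by (simp flip: sum_divide_distrib)
qed

end

section \<open>Union bound over the vectors of a random eigenbasis\<close>

theorem theorem1p3:
  fixes G :: "'v::finite pair_pre_digraph"
    and H :: "nat \<Rightarrow> sqmat measure"
    and b :: "real \<Rightarrow> nat \<Rightarrow> real ^ 'v"
    and M :: nat
    and f :: "nat \<Rightarrow> real ^ 'v"
    and t :: real
  assumes graph: "pair_graph G"
    and vertices: "pverts G = UNIV"
    and conn: "Digraph_Component.connected (with_proj G)"
    and transitive: "vertex_transitive G"
    and haar: "\<And>m. haar_probability m (H m)"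
    and reference: "\<And>l. l \<in> eigenvalues (adjacency_matrix G) \<Longrightarrow>
      b l \<in> orthonormal_bases (eigenspace (adjacency_matrix G) l)"
    and t_pos: "t > 0"
  shows "\<P>(\<omega> in eigenbasis_measure (adjacency_matrix G) H b.
      \<forall>u \<in> basis_vectors (adjacency_matrix G) \<omega>. \<forall>i \<in> {1..M}.
        \<bar>(\<Sum>x\<in>UNIV. f i $ x * (u $ x)\<^sup>2) - 1 / real CARD('v) * (\<Sum>x\<in>UNIV. f i $ x)\<bar>
          \<le> t * (norm (f i) / sqrt (real CARD('v))))
    \<ge> 1 - real M * (\<Sum>l\<in>nontrivial_eigenvalues G.
        let m = real (multiplicity_of (adjacency_matrix G) l)
        in m * (3 * exp (- (t * sqrt m / 8)) + exp (- (m / 12))))"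
proof -
  interpret vertex_transitive_graph G
    by (rule vertex_transitive_graph.intro[OF graph vertices conn transitive])
  let ?E = "eigenvalues A" and ?mu = "multiplicity_of A" and ?F = "eigenspace A" and ?n = "real CARD('v)"
  let ?d = "real (common_degree G)"
  define bad where "bad = (\<lambda>i. {u. t * (norm (f i) / sqrt ?n)
        < \<bar>(\<Sum>x\<in>UNIV. f i $ x * (u $ x)\<^sup>2) - 1 / ?n * (\<Sum>x\<in>UNIV. f i $ x)\<bar>})"
  have [measurable]: "bad i \<in> sets borel" for i unfolding bad_def by measurable
  define N where "N = (\<lambda>l. distr (H (?mu l)) (onb_space (?F l)) (onb_of_matrix (?F l) (b l)))"
  define P where "P = eigenbasis_measure A H b"
  have P: "P = PiM ?E N" by (simp add: P_def eigenbasis_measure_def N_def)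
  have mu: "dim (?F l) = ?mu l" for l by (simp add: multiplicity_of_def)
  interpret H: haar_group "?mu l" "H (?mu l)" for l by unfold_locales (rule haar)
  have onb: "onb_of_matrix (?F l) (b l) \<in> measurable (H (?mu l)) (onb_space (?F l))" if "l \<in> ?E" for l
    by (rule H.measurable_onb_of_matrix[OF subspace_eigenspace mu reference[OF that]])
  have N: "prob_space (N l)" if "l \<in> ?E" for l
    unfolding N_def using onb[OF that] by (rule H.prob_space_distr)
  interpret prob_space P unfolding P by (rule prob_space_PiM) (rule N)
  have space_N: "space (N l) = orthonormal_bases (?F l)" for l
    by (auto simp: N_def onb_space_def space_restrict_space space_PiM orthonormal_bases_def)
  have vector_meas: "(\<lambda>e. e j) \<in> borel_measurable (N l)" if "j < ?mu l" for l j
    using that by (auto simp: N_def onb_space_def mu intro!: measurable_restrict_space1 measurable_component_singleton)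
  have comp: "(\<lambda>\<omega>. \<omega> l) \<in> measurable P (N l)" if "l \<in> ?E" for l
    unfolding P using that by (rule measurable_component_singleton)
  define B where "B = (\<lambda>(l, j, i). {\<omega> \<in> space P. \<omega> l j \<in> bad i})"
  define I where "I = (SIGMA l : ?E. {..<?mu l} \<times> {1..M})"
  have "finite I" unfolding I_def by (intro finite_SigmaI finite_eigenvalues) auto
  have B: "B (l, j, i) \<in> sets P" if "l \<in> ?E" "j < ?mu l" for l j i
    using measurable_sets[OF measurable_compose[OF comp[OF that(1)] vector_meas[OF that(2)]], of "bad i"]
    by (simp add: B_def vimage_def Int_def conj_commute)
  define p where "p = (\<lambda>m. 3 * exp (- (t * sqrt m / 8)) + exp (- (m / 12)))"
  \<comment> \<open>The bound 0 at the trivial eigenvalue is what leaves only nontrivial eigenvalues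
    in the final sum.\<close>
  have tail: "prob (B (l, j, i)) \<le> (if l = ?d then 0 else p (?mu l))" if l: "l \<in> ?E" and j: "j < ?mu l" for l j i
  proof (cases "l = ?d")
    case True
    have "\<omega> l j \<notin> bad i" if "\<omega> \<in> space P" for \<omega>
    proof -
      have "\<omega> l \<in> orthonormal_bases (?F l)"
        using measurable_space[OF comp[OF l] that] by (simp add: space_N)
      then have e: "orthonormal_basis_of (?F l) (?mu l) (\<omega> l)" by (simp add: orthonormal_bases_iff mu)
      have "\<omega> l j \<in> ?F ?d" "\<omega> l j \<bullet> \<omega> l j = 1"
        using orthonormal_basis_of_mem[OF e j] e j True
        by (simp_all add: orthonormal_basis_of_def orthonormal_system_def)
      from trivial_eigenvector_deviation[OF this, of "f i"] show ?thesis
        using t_pos by (simp add: bad_def not_less)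
    qed
    then have "B (l, j, i) = {}" by (auto simp: B_def)
    then show ?thesis using True by simp
  next
    case False
    have bl: "orthonormal_basis_of (?F l) (?mu l) (b l)"
      using reference[OF l] by (simp add: orthonormal_bases_iff mu)
    have ind: "(\<lambda>e. indicator (bad i) (e j) :: ennreal) \<in> borel_measurable (N l)"
      using vector_meas[OF j] by (rule measurable_compose) measurable
    have "emeasure P (B (l, j, i)) = (\<integral>\<^sup>+\<omega>. indicator (bad i) (\<omega> l j) \<partial>P)"
      using B[OF l j] by (simp add: B_def indicator_def flip: nn_integral_indicator) (auto intro: nn_integral_cong)
    also have "\<dots> = (\<integral>\<^sup>+e. indicator (bad i) (e j) \<partial>distr P (N l) (\<lambda>\<omega>. \<omega> l))"
      using ind by (intro nn_integral_distr[symmetric] comp[OF l]) simp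
    \<comment> \<open>The marginal of the product at \<open>l\<close> is an image of Haar measure,
      so the integral returns to \<open>H (?mu l)\<close>.\<close>
    also have "distr P (N l) (\<lambda>\<omega>. \<omega> l) = N l"
      unfolding P by (rule distr_PiM_component[OF N l])
    also have "(\<integral>\<^sup>+e. indicator (bad i) (e j) \<partial>N l)
        = (\<integral>\<^sup>+Q. indicator (bad i) (onb_of_matrix (?F l) (b l) Q j) \<partial>H (?mu l))"
      using ind unfolding N_def by (intro nn_integral_distr onb[OF l]) simp
    also have "\<dots> = (\<integral>\<^sup>+Q. indicator (bad i) (\<Sum>k<?mu l. Q (k, j) *\<^sub>R b l k) \<partial>H (?mu l))"
      using j by (simp add: onb_of_matrix_def mu)
    also have "\<dots> \<le> ennreal (p (?mu l))"
      unfolding bad_def p_def by (rule random_eigenvector_tail[OF haar bl mu j t_pos])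
    finally have "ennreal (prob (B (l, j, i))) \<le> ennreal (p (?mu l))" by (simp add: emeasure_eq_measure)
    moreover have "0 \<le> p (?mu l)" by (simp add: p_def)
    ultimately show ?thesis using False by (simp only: ennreal_le_iff if_False)
  qed
  let ?U = "\<Union>x\<in>I. B x"
  have U: "?U \<in> sets P" using \<open>finite I\<close> B by (intro sets.finite_UN) (auto simp: I_def)
  have "prob ?U \<le> (\<Sum>x\<in>I. prob (B x))"
    using \<open>finite I\<close> B by (intro finite_measure_subadditive_finite) (auto simp: I_def)
  also have "\<dots> \<le> (\<Sum>x\<in>I. if fst x = ?d then 0 else p (?mu (fst x)))"
  proof (rule sum_mono)
    fix x assume "x \<in> I"
    then obtain l j i where "x = (l, j, i)" "l \<in> ?E" "j < ?mu l" by (auto simp: I_def)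
    then show "prob (B x) \<le> (if fst x = ?d then 0 else p (?mu (fst x)))" using tail[of l j i] by (simp only: fst_conv)
  qed
  also have "\<dots> = (\<Sum>l\<in>?E. \<Sum>x\<in>{..<?mu l} \<times> {1..M}. if l = ?d then 0 else p (?mu l))"
    unfolding I_def using finite_eigenvalues by (subst sum.Sigma) (auto intro!: sum.cong)
  \<comment> \<open>Each eigenvalue contributes \<open>?mu l\<close> basis vectors, each tested
    against \<open>M\<close> functions.\<close>
  also have "\<dots> = (\<Sum>l\<in>?E. if l = ?d then 0 else real M * (?mu l * p (?mu l)))"
    by (intro sum.cong) (auto simp: card_cartesian_product)
  also have "\<dots> = (\<Sum>l\<in>?E - {?d}. real M * (?mu l * p (?mu l)))"
    using finite_eigenvalues by (intro sum.mono_neutral_cong_right) auto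
  also have "\<dots> = real M * (\<Sum>l\<in>nontrivial_eigenvalues G. ?mu l * p (?mu l))"
    by (simp add: nontrivial_eigenvalues_def sum_distrib_left)
  finally have "1 - real M * (\<Sum>l\<in>nontrivial_eigenvalues G. ?mu l * p (?mu l)) \<le> prob (space P - ?U)"
    using prob_compl[OF U] by simp
  \<comment> \<open>The index set \<open>I\<close> covers every basis vector and every function, so
    the complement of the union is exactly the event of the theorem.\<close>
  also have "space P - ?U = {\<omega> \<in> space P. \<forall>u \<in> basis_vectors A \<omega>. \<forall>i \<in> {1..M}. u \<notin> bad i}"
    by (auto simp: I_def B_def basis_vectors_def)
  finally show ?thesis by (simp only: P_def p_def Let_def bad_def mem_Collect_eq not_less)
qed

end
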